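(* Let $n\ge 1$, let $W=W(A_{2n})$ be the Coxeter group of type $A_{2n}$ with longest element $w_o$, and let $W_o\subset W$ be the subgroup of elements commuting with $w_o$. For integers $l\in\{0,\dots,n\}$ and $k\in\{0,\dots,\lfloor (n-l)/2\rfloor\}$ let $$I_{k,l}=\{2i-1 : 1\le i\le k\}\cup\{2n+2-2i : 1\le i\le k\}\cup\{j : n-l+1\le j\le n+l\}\subset\{1,\dots,2n\}$$ and $c_{k,l}:=w_{I_{k,l}}$. Then each $c_{k,l}$ is an involution in $W_o$; each involution in $W_o$ is conjugate in $W_o$ to precisely one of the involutions $c_{k,l}$; and for all such $k,l$ the element $w_o c_{k,l}$ is conjugate in $W_o$ to $c_{k,\,n-2k-l}$.
   Context: The nodes of the Coxeter graph $A_{2n}$ are numbered $1,\dots,2n$ along the path; node $i$ corresponds to the simple generator $s_i$ of $W(A_{2n})$. For a set of nodes $I$, $W_I$ denotes the parabolic subgroup generated by $\{s_i: i\in I\}$, and $w_I$ denotes its longest element. An involution is an element $x$ with $x^2=1$ (the identity is included). *)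

theory Defs
  imports "HOL-Algebra.Generated_Groups"
begin

section \<open>Coxeter groups by generators and relations\<close>

text \<open>
  A Coxeter matrix \<open>m\<close> on a set \<open>S\<close> has \<open>m s s = 1\<close> for all \<open>s\<close>, and entry \<open>0\<close> stands for
  \<open>\<infinity>\<close>. Since every simple generator is its own inverse, the group
  \<open>\<langle>S | (s t)\<^bsup>m s t\<^esup> = 1\<rangle>\<close> is the quotient of the free monoid on \<open>S\<close> by the congruence generated
  by these relations; an element of the group is thus a class of words over \<open>S\<close>.
\<close>

inductive coxeter_equiv :: "'a set \<Rightarrow> ('a \<Rightarrow> 'a \<Rightarrow> nat) \<Rightarrow> 'a list \<Rightarrow> 'a list \<Rightarrow> bool"
  for S m where
  rel: "\<lbrakk>xs \<in> lists S; ys \<in> lists S; s \<in> S; t \<in> S\<rbrakk> \<Longrightarrow>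
     coxeter_equiv S m (xs @ concat (replicate (m s t) [s, t]) @ ys) (xs @ ys)"
| refl: "xs \<in> lists S \<Longrightarrow> coxeter_equiv S m xs xs"
| sym: "coxeter_equiv S m xs ys \<Longrightarrow> coxeter_equiv S m ys xs"
| trans: "\<lbrakk>coxeter_equiv S m xs ys; coxeter_equiv S m ys zs\<rbrakk> \<Longrightarrow> coxeter_equiv S m xs zs"

definition coxeter_rel :: "'a set \<Rightarrow> ('a \<Rightarrow> 'a \<Rightarrow> nat) \<Rightarrow> ('a list \<times> 'a list) set" where
  "coxeter_rel S m = {(xs, ys). coxeter_equiv S m xs ys}"

definition coxeter_group :: "'a set \<Rightarrow> ('a \<Rightarrow> 'a \<Rightarrow> nat) \<Rightarrow> 'a list set monoid" where
  "coxeter_group S m =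
     \<lparr>carrier = lists S // coxeter_rel S m,
      monoid.mult = (\<lambda>X Y. \<Union>x\<in>X. \<Union>y\<in>Y. coxeter_rel S m `` {x @ y}),
      one = coxeter_rel S m `` {[]}\<rparr>"

definition simple_gen :: "'a set \<Rightarrow> ('a \<Rightarrow> 'a \<Rightarrow> nat) \<Rightarrow> 'a \<Rightarrow> 'a list set" where
  "simple_gen S m s = coxeter_rel S m `` {[s]}"

text \<open>As a group element is the set of all words representing it, its Coxeter length is the least
  length of a member.\<close>

definition coxeter_length :: "'a list set \<Rightarrow> nat" where
  "coxeter_length w = (LEAST k. \<exists>xs\<in>w. length xs = k)"

definition parabolic :: "'a set \<Rightarrow> ('a \<Rightarrow> 'a \<Rightarrow> nat) \<Rightarrow> 'a set \<Rightarrow> 'a list set set" where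
  "parabolic S m I = generate (coxeter_group S m) (simple_gen S m ` I)"

text \<open>Only meaningful if \<open>parabolic S m I\<close> is finite; then the element of maximal length is unique.\<close>

definition longest_elt :: "'a set \<Rightarrow> ('a \<Rightarrow> 'a \<Rightarrow> nat) \<Rightarrow> 'a set \<Rightarrow> 'a list set" where
  "longest_elt S m I =
     (THE w. w \<in> parabolic S m I \<and> (\<forall>v\<in>parabolic S m I. coxeter_length v \<le> coxeter_length w))"


section \<open>Well-definedness: the construction yields a group\<close>

lemma coxeter_equiv_lists:
  "coxeter_equiv S m xs ys \<Longrightarrow> xs \<in> lists S \<and> ys \<in> lists S"
proof (induction rule: coxeter_equiv.induct)
  case (rel xs ys s t)
  have "concat (replicate k [s, t]) \<in> lists S" for k
    using rel by (induction k) auto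
  then show ?case using rel by auto
qed auto

lemma coxeter_equiv_append_left:
  assumes "coxeter_equiv S m xs ys" and "zs \<in> lists S"
  shows "coxeter_equiv S m (zs @ xs) (zs @ ys)"
  using assms
proof (induction rule: coxeter_equiv.induct)
  case (rel xs ys s t)
  then show ?case using coxeter_equiv.rel[of "zs @ xs" S ys s t m] by simp
next
  case (refl xs)
  then show ?case by (simp add: coxeter_equiv.refl)
next
  case (sym xs ys)
  then show ?case by (simp add: coxeter_equiv.sym)
next
  case (trans xs ys ws)
  then show ?case using coxeter_equiv.trans by blast
qed

lemma coxeter_equiv_append_right:
  assumes "coxeter_equiv S m xs ys" and "zs \<in> lists S"
  shows "coxeter_equiv S m (xs @ zs) (ys @ zs)"
  using assms
proof (induction rule: coxeter_equiv.induct)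
  case (rel xs ys s t)
  then show ?case using coxeter_equiv.rel[of xs S "ys @ zs" s t m] by simp
next
  case (refl xs)
  then show ?case by (simp add: coxeter_equiv.refl)
next
  case (sym xs ys)
  then show ?case by (simp add: coxeter_equiv.sym)
next
  case (trans xs ys ws)
  then show ?case using coxeter_equiv.trans by blast
qed

lemma coxeter_equiv_append:
  assumes "coxeter_equiv S m xs xs'" and "coxeter_equiv S m ys ys'"
  shows "coxeter_equiv S m (xs @ ys) (xs' @ ys')"
  using coxeter_equiv.trans[OF coxeter_equiv_append_right[OF assms(1)] coxeter_equiv_append_left[OF assms(2)]]
    coxeter_equiv_lists[OF assms(1)] coxeter_equiv_lists[OF assms(2)]
  by blast

lemma equiv_coxeter_rel: "equiv (lists S) (coxeter_rel S m)"
proof (rule equivI)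
  show "coxeter_rel S m \<subseteq> lists S \<times> lists S"
    using coxeter_equiv_lists by (fastforce simp: coxeter_rel_def)
  show "refl_on (lists S) (coxeter_rel S m)"
    by (auto simp: coxeter_rel_def refl_on_def intro: coxeter_equiv.refl)
  show "sym (coxeter_rel S m)"
    unfolding coxeter_rel_def sym_def by (blast intro: coxeter_equiv.sym)
  show "trans (coxeter_rel S m)"
    unfolding coxeter_rel_def trans_def by (blast intro: coxeter_equiv.trans)
qed

lemma coxeter_mult_class:
  assumes "xs \<in> lists S" and "ys \<in> lists S"
  shows "coxeter_rel S m `` {xs} \<otimes>\<^bsub>coxeter_group S m\<^esub> coxeter_rel S m `` {ys}
       = coxeter_rel S m `` {xs @ ys}"
proof -
  have "coxeter_rel S m `` {x @ y} = coxeter_rel S m `` {xs @ ys}"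
    if "x \<in> coxeter_rel S m `` {xs}" "y \<in> coxeter_rel S m `` {ys}" for x y
  proof (rule equiv_class_eq[OF equiv_coxeter_rel, symmetric])
    show "(xs @ ys, x @ y) \<in> coxeter_rel S m"
      using that by (auto simp: coxeter_rel_def intro: coxeter_equiv_append)
  qed
  moreover have "xs \<in> coxeter_rel S m `` {xs}" "ys \<in> coxeter_rel S m `` {ys}"
    using assms by (auto simp: coxeter_rel_def intro: coxeter_equiv.refl)
  ultimately have "(\<Union>x\<in>coxeter_rel S m `` {xs}. \<Union>y\<in>coxeter_rel S m `` {ys}. coxeter_rel S m `` {x @ y})
       = coxeter_rel S m `` {xs @ ys}"
    by blast
  then show ?thesis by (simp add: coxeter_group_def)
qed

lemma coxeter_rev_left_inverse:
  assumes "\<And>s. s \<in> S \<Longrightarrow> m s s = 1" and "xs \<in> lists S"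
  shows "coxeter_equiv S m (rev xs @ xs) []"
  using assms(2)
proof (induction xs)
  case Nil
  then show ?case by (auto intro: coxeter_equiv.refl)
next
  case (Cons s xs)
  then have "s \<in> S" "xs \<in> lists S" "rev xs \<in> lists S" by auto
  then have "coxeter_equiv S m (rev xs @ [s, s] @ xs) (rev xs @ xs)"
    using coxeter_equiv.rel[of "rev xs" S xs s s m] assms(1) by simp
  then show ?case
    using coxeter_equiv.trans[OF _ Cons.IH] \<open>xs \<in> lists S\<close> by simp
qed

lemma group_coxeter_group:
  assumes "\<And>s. s \<in> S \<Longrightarrow> m s s = 1"
  shows "group (coxeter_group S m)"
proof (rule groupI)
  let ?W = "coxeter_group S m" and ?c = "\<lambda>xs. coxeter_rel S m `` {xs}"
  have car: "?c xs \<in> carrier ?W" if "xs \<in> lists S" for xs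
    using that unfolding coxeter_group_def by (simp add: quotientI)
  have carE: "\<exists>xs. xs \<in> lists S \<and> X = ?c xs" if "X \<in> carrier ?W" for X
    using that unfolding coxeter_group_def by (auto simp: quotient_def simp del: in_lists_conv_set)
  have one: "\<one>\<^bsub>?W\<^esub> = ?c []" by (simp add: coxeter_group_def)
  have app: "xs @ ys \<in> lists S" if "xs \<in> lists S" "ys \<in> lists S" for xs ys
    using that by simp
  note mult = coxeter_mult_class[where S = S and m = m]
  show "X \<otimes>\<^bsub>?W\<^esub> Y \<in> carrier ?W" if X: "X \<in> carrier ?W" and Y: "Y \<in> carrier ?W" for X Y
  proof -
    obtain xs ys where "xs \<in> lists S" "X = ?c xs" "ys \<in> lists S" "Y = ?c ys"
      using carE[OF X] carE[OF Y] by blast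
    then show ?thesis by (simp only: mult app car)
  qed
  show "\<one>\<^bsub>?W\<^esub> \<in> carrier ?W" unfolding one by (rule car) simp
  show "X \<otimes>\<^bsub>?W\<^esub> Y \<otimes>\<^bsub>?W\<^esub> Z = X \<otimes>\<^bsub>?W\<^esub> (Y \<otimes>\<^bsub>?W\<^esub> Z)"
    if X: "X \<in> carrier ?W" and Y: "Y \<in> carrier ?W" and Z: "Z \<in> carrier ?W" for X Y Z
  proof -
    obtain xs ys zs where "xs \<in> lists S" "X = ?c xs" "ys \<in> lists S" "Y = ?c ys"
        "zs \<in> lists S" "Z = ?c zs"
      using carE[OF X] carE[OF Y] carE[OF Z] by blast
    then show ?thesis by (simp only: mult app append_assoc)
  qed
  show "\<one>\<^bsub>?W\<^esub> \<otimes>\<^bsub>?W\<^esub> X = X" if X: "X \<in> carrier ?W" for X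
  proof -
    obtain xs where "xs \<in> lists S" "X = ?c xs"
      using carE[OF X] by blast
    then show ?thesis using mult[of "[]" xs] one by simp
  qed
  show "\<exists>Y\<in>carrier ?W. Y \<otimes>\<^bsub>?W\<^esub> X = \<one>\<^bsub>?W\<^esub>" if X: "X \<in> carrier ?W" for X
  proof -
    obtain xs where xs: "xs \<in> lists S" "X = ?c xs" using carE[OF X] by blast
    then have rev: "rev xs \<in> lists S" by auto
    have "?c (rev xs @ xs) = ?c []"
      using coxeter_rev_left_inverse[of S m xs] assms xs(1)
      by (intro equiv_class_eq[OF equiv_coxeter_rel]) (auto simp: coxeter_rel_def)
    then have "?c (rev xs) \<otimes>\<^bsub>?W\<^esub> X = \<one>\<^bsub>?W\<^esub>"
      using mult[OF rev xs(1)] xs(2) one by simp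
    moreover have "?c (rev xs) \<in> carrier ?W" by (rule car[OF rev])
    ultimately show ?thesis by blast
  qed
qed


section \<open>Type \<open>A\<close>\<close>

definition A_matrix :: "nat \<Rightarrow> nat \<Rightarrow> nat" where
  "A_matrix i j = (if i = j then 1 else if i = Suc j \<or> j = Suc i then 3 else 2)"

abbreviation A_group :: "nat \<Rightarrow> nat list set monoid" where
  "A_group r \<equiv> coxeter_group {1..r} A_matrix"

lemma group_A_group: "group (A_group r)"
  by (rule group_coxeter_group) (simp add: A_matrix_def)

abbreviation A_longest :: "nat \<Rightarrow> nat set \<Rightarrow> nat list set" where
  "A_longest r I \<equiv> longest_elt {1..r} A_matrix I"

definition A_w0 :: "nat \<Rightarrow> nat list set" where
  "A_w0 r = A_longest r {1..r}"

definition A_W0 :: "nat \<Rightarrow> nat list set set" where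
  "A_W0 r = {x \<in> carrier (A_group r). x \<otimes>\<^bsub>A_group r\<^esub> A_w0 r = A_w0 r \<otimes>\<^bsub>A_group r\<^esub> x}"


section \<open>Involutions and conjugacy\<close>

definition involution :: "('a, 'b) monoid_scheme \<Rightarrow> 'a \<Rightarrow> bool" where
  "involution G x \<longleftrightarrow> x \<in> carrier G \<and> x \<otimes>\<^bsub>G\<^esub> x = \<one>\<^bsub>G\<^esub>"

definition conjugate_in :: "('a, 'b) monoid_scheme \<Rightarrow> 'a set \<Rightarrow> 'a \<Rightarrow> 'a \<Rightarrow> bool" where
  "conjugate_in G H x y \<longleftrightarrow> (\<exists>g\<in>H. y = g \<otimes>\<^bsub>G\<^esub> x \<otimes>\<^bsub>G\<^esub> inv\<^bsub>G\<^esub> g)"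

definition kl_pairs :: "nat \<Rightarrow> (nat \<times> nat) set" where
  "kl_pairs n = {(k, l). l \<le> n \<and> k \<le> (n - l) div 2}"

definition I_kl :: "nat \<Rightarrow> nat \<Rightarrow> nat \<Rightarrow> nat set" where
  "I_kl n k l = {2 * i - 1 | i. 1 \<le> i \<and> i \<le> k} \<union> {2 * n + 2 - 2 * i | i. 1 \<le> i \<and> i \<le> k}
     \<union> {j. n - l + 1 \<le> j \<and> j \<le> n + l}"

definition c_kl :: "nat \<Rightarrow> nat \<Rightarrow> nat \<Rightarrow> nat list set" where
  "c_kl n k l = A_longest (2 * n) (I_kl n k l)"

end

(*
  A(2n) acts faithfully on {1..2n+1} (words have the normal form w D with D a descending run), and the
  Coxeter length is the number of inversions, so the longest element of a parabolic subgroup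
  reverses every block. In particular w_o is the flip j -> 2n+2-j.
  An involution x commuting with the flip is an action of the Klein four-group on {1..2n+1} fixing
  n+1. Such an action is determined up to isomorphism, i.e. x up to conjugacy in the centralizer of
  the flip, by the number 2l of points p with x p = flip p \<noteq> p and the number 4k of points with free
  orbit. These numbers are exactly those of c_kl, and multiplying x by w_o swaps the points
  fixed by x with those flipped by x.
*)

theory Submission
  imports Defs "HOL-Combinatorics.Permutations"
begin

section \<open>Words and permutations\<close>

text \<open>The group is given by a presentation, so the first obstacle is that the relations must
  suffice: a word acting trivially has to reduce to the empty word. Induction on the rank works
  because a nonempty descending run carries a lower point to the top point, which the remaining
  letters fix. Afterwards length is a matter of inversion sets. An element of a parabolic subgroup
  inverts only pairs inside one block, and the inversion set determines the permutation; this gives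
  the uniqueness that the definite description of a longest element demands. The number of points is
  odd, so the flip has a single fixed point, and every permutation commuting with the flip fixes it.
  The remaining 2n points are fixed by x, flipped by x, or in free orbits, so two of the three
  counts determine the third. Orbit sizes force the last two to be 2l and 4k, and 2l + 4k \<le> 2n
  is exactly the admissible range of (k, l). The third count 2(n - 2k - l) is the origin of the last
  index.\<close>

declare upt_Suc [simp del]

primrec word_perm :: "nat list \<Rightarrow> nat \<Rightarrow> nat" where
  "word_perm [] = id"
| "word_perm (i # xs) = transpose i (Suc i) \<circ> word_perm xs"

lemma word_perm_append: "word_perm (xs @ ys) = word_perm xs \<circ> word_perm ys"
  by (induction xs) (auto simp: comp_assoc)

lemma bij_word_perm: "bij (word_perm xs)"
  by (induction xs) (simp_all add: bij_comp del: id_apply comp_apply)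

lemma word_perm_relation: "word_perm (concat (replicate (A_matrix s t) [s, t])) = id"
proof -
  consider "s = t" | "s = Suc t" | "t = Suc s" | "s \<noteq> t" "s \<noteq> Suc t" "t \<noteq> Suc s" by blast
  then show ?thesis
    by cases (auto simp: A_matrix_def eval_nat_numeral fun_eq_iff transpose_def)
qed

lemma word_perm_coxeter_equiv:
  "coxeter_equiv S A_matrix xs ys \<Longrightarrow> word_perm xs = word_perm ys"
  by (induction rule: coxeter_equiv.induct) (auto simp: word_perm_append word_perm_relation)

section \<open>Commutation and braid moves derived from the relations\<close>

lemma coxeter_equiv_mono:
  "coxeter_equiv S m xs ys \<Longrightarrow> S \<subseteq> T \<Longrightarrow> coxeter_equiv T m xs ys"
proof (induction rule: coxeter_equiv.induct)
  case (rel xs ys s t)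
  then show ?case by (intro coxeter_equiv.rel) auto
next
  case (refl xs)
  then show ?case by (intro coxeter_equiv.refl) auto
qed (blast intro: coxeter_equiv.sym coxeter_equiv.trans)+

lemma A_equiv_square:
  assumes "xs \<in> lists S" "ys \<in> lists S" "s \<in> S"
  shows "coxeter_equiv S A_matrix (xs @ [s, s] @ ys) (xs @ ys)"
  using coxeter_equiv.rel[OF assms(1,2,3,3), of A_matrix] by (simp add: A_matrix_def)

text \<open>The word \<open>[s, t, s, t, t, s]\<close> reduces in two ways: by the relation of order
  2 at its front, and by cancelling equal neighbours. The braid move below comes from the relation
  of order 3 in the same manner.\<close>

lemma A_equiv_commute:
  assumes "s \<in> S" "t \<in> S" "s \<noteq> t" "s \<noteq> Suc t" "t \<noteq> Suc s"
  shows "coxeter_equiv S A_matrix [s, t] [t, s]"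
proof -
  have 1: "coxeter_equiv S A_matrix [s, t, s, t, t, s] [t, s]"
    using coxeter_equiv.rel[of "[]" S "[t, s]" s t A_matrix] assms
    by (simp add: A_matrix_def eval_nat_numeral)
  have 2: "coxeter_equiv S A_matrix [s, t, s, t, t, s] [s, t, s, s]"
    using A_equiv_square[of "[s, t, s]" S "[s]" t] assms by simp
  have 3: "coxeter_equiv S A_matrix [s, t, s, s] [s, t]"
    using A_equiv_square[of "[s, t]" S "[]" s] assms by simp
  show ?thesis
    using 1 2 3 by (meson coxeter_equiv.sym coxeter_equiv.trans)
qed

lemma A_equiv_braid:
  assumes "Suc t \<in> S" "t \<in> S"
  shows "coxeter_equiv S A_matrix [Suc t, t, Suc t] [t, Suc t, t]"
proof -
  let ?s = "Suc t"
  have 1: "coxeter_equiv S A_matrix [?s, t, ?s, t, ?s, t, t, ?s, t] [t, ?s, t]"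
    using coxeter_equiv.rel[of "[]" S "[t, ?s, t]" ?s t A_matrix] assms
    by (simp add: A_matrix_def eval_nat_numeral)
  have 2: "coxeter_equiv S A_matrix [?s, t, ?s, t, ?s, t, t, ?s, t] [?s, t, ?s, t, ?s, ?s, t]"
    using A_equiv_square[of "[?s, t, ?s, t, ?s]" S "[?s, t]" t] assms by simp
  have 3: "coxeter_equiv S A_matrix [?s, t, ?s, t, ?s, ?s, t] [?s, t, ?s, t, t]"
    using A_equiv_square[of "[?s, t, ?s, t]" S "[t]" ?s] assms by simp
  have 4: "coxeter_equiv S A_matrix [?s, t, ?s, t, t] [?s, t, ?s]"
    using A_equiv_square[of "[?s, t, ?s]" S "[]" t] assms by simp
  show ?thesis
    using 1 2 3 4 by (meson coxeter_equiv.sym coxeter_equiv.trans)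
qed

lemma A_equiv_commute_word:
  assumes "j \<in> S" "xs \<in> lists S" "\<And>i. i \<in> set xs \<Longrightarrow> Suc j < i \<or> Suc i < j"
  shows "coxeter_equiv S A_matrix (xs @ [j]) (j # xs)"
  using assms(2,3)
proof (induction xs)
  case Nil
  then show ?case using assms(1) by (auto intro: coxeter_equiv.refl)
next
  case (Cons i xs)
  then have "coxeter_equiv S A_matrix ([i] @ (xs @ [j])) ([i] @ (j # xs))"
    by (intro coxeter_equiv_append_left) auto
  moreover have "Suc j < i \<or> Suc i < j" using Cons.prems by simp
  then have "coxeter_equiv S A_matrix ([i, j] @ xs) ([j, i] @ xs)"
    using Cons.hyps assms(1)
    by (intro coxeter_equiv_append_right A_equiv_commute) auto
  ultimately show ?case by (auto intro: coxeter_equiv.trans)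
qed

text \<open>The descending run \<open>r + 1, \<dots>, k\<close> is the minimal representative of its coset of
  \<open>W(A\<^sub>r)\<close> in \<open>W(A\<^sub>r\<^sub>+\<^sub>1)\<close>; it is empty for \<open>k = r + 2\<close>.\<close>

lemma A_equiv_run_append:
  assumes "j \<in> {1..Suc r}" "k \<in> {1..r + 2}"
  shows "\<exists>ys\<in>lists {1..r}. \<exists>k'\<in>{1..r + 2}.
    coxeter_equiv {1..Suc r} A_matrix (rev [k..<r + 2] @ [j]) (ys @ rev [k'..<r + 2])"
proof -
  let ?E = "coxeter_equiv {1..Suc r} A_matrix"
  \<comment> \<open>A generator multiplied onto a coset representative from the right either gives
    another representative (the run grows in \<open>ext\<close>, shrinks in \<open>eq\<close>) or
    passes to the left as a generator of the smaller group: as \<open>j\<close> itself in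
    \<open>low\<close>, as \<open>j - 1\<close> after a braid move in \<open>high\<close>.\<close>
  consider (low) "Suc j < k" | (ext) "Suc j = k" | (eq) "j = k" | (high) "k < j" by linarith
  then show ?thesis
  proof cases
    case low
    have "?E (rev [k..<r + 2] @ [j]) (j # rev [k..<r + 2])"
      using assms low by (intro A_equiv_commute_word) auto
    then have "?E (rev [k..<r + 2] @ [j]) ([j] @ rev [k..<r + 2])" by simp
    moreover have "[j] \<in> lists {1..r}" using low assms by auto
    ultimately show ?thesis using assms(2) by blast
  next
    case ext
    then have "rev [k..<r + 2] @ [j] = [] @ rev [j..<r + 2]"
      using assms by (subst (2) upt_conv_Cons) auto
    moreover have "?E (rev [k..<r + 2] @ [j]) (rev [k..<r + 2] @ [j])"
      using assms by (intro coxeter_equiv.refl) auto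
    ultimately have "?E (rev [k..<r + 2] @ [j]) ([] @ rev [j..<r + 2])" by (simp only:)
    moreover have "[] \<in> lists {1..r}" "j \<in> {1..r + 2}" using assms by auto
    ultimately show ?thesis by blast
  next
    case eq
    then have "rev [k..<r + 2] @ [j] = rev [Suc k..<r + 2] @ [k, k] @ []"
      using assms by (subst upt_conv_Cons) auto
    moreover have "?E (rev [Suc k..<r + 2] @ [k, k] @ []) (rev [Suc k..<r + 2] @ [])"
      using assms eq by (intro A_equiv_square) auto
    ultimately have "?E (rev [k..<r + 2] @ [j]) ([] @ rev [Suc k..<r + 2])" by simp
    moreover have "[] \<in> lists {1..r}" "Suc k \<in> {1..r + 2}" using assms eq by auto
    ultimately show ?thesis by blast
  next
    case high
    then have i: "j = Suc (j - 1)" "k \<le> j - 1" by auto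
    then obtain i where i: "j = Suc i" "k \<le> i" by blast
    define A B where "A = rev [Suc j..<r + 2]" and "B = rev [k..<i]"
    have "[k..<r + 2] = [k..<i] @ [i..<r + 2]"
      using i assms upt_add_eq_append[of k i "r + 2 - i"] by auto
    also have "[i..<r + 2] = [i, j] @ [Suc j..<r + 2]"
      using i assms by (simp add: upt_conv_Cons del: upt_Suc)
    finally have D: "rev [k..<r + 2] = A @ [Suc i, i] @ B" by (simp add: A_def B_def i)
    have AB: "A \<in> lists {1..Suc r}" "B \<in> lists {1..Suc r}" "i \<in> {1..Suc r}" "Suc i \<in> {1..Suc r}"
      using assms i by (auto simp: A_def B_def)
    have "?E (B @ [Suc i]) (Suc i # B)"
      using AB by (intro A_equiv_commute_word) (auto simp: B_def)
    then have "?E ((A @ [Suc i, i]) @ (B @ [Suc i])) ((A @ [Suc i, i]) @ (Suc i # B))"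
      using AB by (intro coxeter_equiv_append_left) auto
    then have 1: "?E (rev [k..<r + 2] @ [j]) (A @ [Suc i, i, Suc i] @ B)"
      unfolding D i(1) by simp
    have 2: "?E (A @ [Suc i, i, Suc i] @ B) (A @ [i, Suc i, i] @ B)"
      using AB by (intro coxeter_equiv_append_left coxeter_equiv_append_right A_equiv_braid) auto
    have "?E (A @ [i]) (i # A)"
      using AB i by (intro A_equiv_commute_word) (auto simp: A_def)
    then have "?E ((A @ [i]) @ [Suc i, i] @ B) ((i # A) @ [Suc i, i] @ B)"
      using AB by (intro coxeter_equiv_append_right) auto
    then have 3: "?E (A @ [i, Suc i, i] @ B) ([i] @ rev [k..<r + 2])"
      unfolding D by simp
    have "?E (rev [k..<r + 2] @ [j]) ([i] @ rev [k..<r + 2])"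
      using coxeter_equiv.trans[OF coxeter_equiv.trans[OF 1 2] 3] .
    moreover have "[i] \<in> lists {1..r}" using assms i by auto
    ultimately show ?thesis using assms(2) by blast
  qed
qed

lemma A_equiv_normal_form:
  assumes "xs \<in> lists {1..Suc r}"
  shows "\<exists>ys\<in>lists {1..r}. \<exists>k\<in>{1..r + 2}.
    coxeter_equiv {1..Suc r} A_matrix xs (ys @ rev [k..<r + 2])"
  using assms
proof (induction xs rule: rev_induct)
  case Nil
  have "coxeter_equiv {1..Suc r} A_matrix [] ([] @ rev [r + 2..<r + 2])"
    by (auto intro: coxeter_equiv.refl)
  moreover have "[] \<in> lists {1..r}" "r + 2 \<in> {1..r + 2}" by auto
  ultimately show ?case by blast
next
  case (snoc j xs)
  let ?E = "coxeter_equiv {1..Suc r} A_matrix"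
  have j: "j \<in> {1..Suc r}" using snoc by auto
  have "xs \<in> lists {1..Suc r}" using snoc.prems by simp
  from snoc.IH[OF this] obtain ys k
    where ys: "ys \<in> lists {1..r}" "k \<in> {1..r + 2}" "?E xs (ys @ rev [k..<r + 2])"
    by blast
  obtain zs k' where zs: "zs \<in> lists {1..r}" "k' \<in> {1..r + 2}"
    "?E (rev [k..<r + 2] @ [j]) (zs @ rev [k'..<r + 2])"
    using A_equiv_run_append[OF j ys(2)] by blast
  have "?E (xs @ [j]) ((ys @ rev [k..<r + 2]) @ [j])"
    using ys j by (intro coxeter_equiv_append_right) auto
  moreover have "?E (ys @ (rev [k..<r + 2] @ [j])) (ys @ (zs @ rev [k'..<r + 2]))"
    using ys zs by (intro coxeter_equiv_append_left) (auto simp: in_lists_conv_set)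
  ultimately have "?E (xs @ [j]) ((ys @ zs) @ rev [k'..<r + 2])"
    by (simp only: append_assoc) (rule coxeter_equiv.trans)
  moreover have "ys @ zs \<in> lists {1..r}" using ys zs by simp
  ultimately show ?case using zs by blast
qed

section \<open>Faithfulness of the permutation action\<close>

lemma word_perm_fixes_above:
  "xs \<in> lists {1..r} \<Longrightarrow> r + 2 \<le> j \<Longrightarrow> word_perm xs j = j"
  by (induction xs) (auto simp: transpose_def)

lemma word_perm_run: "k \<le> m \<Longrightarrow> word_perm (rev [k..<m]) k = m"
  by (induction m rule: dec_induct) (auto simp: transpose_def upt_Suc)

lemma word_perm_eq_id_imp_equiv:
  assumes "xs \<in> lists {1..r}" "word_perm xs = id"
  shows "coxeter_equiv {1..r} A_matrix xs []"
  using assms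
proof (induction r arbitrary: xs)
  case 0
  then have "xs = []" by (cases xs) auto
  then show ?case by (auto intro: coxeter_equiv.refl)
next
  case (Suc r)
  obtain ys k where ys: "ys \<in> lists {1..r}" "k \<in> {1..r + 2}"
    and eq: "coxeter_equiv {1..Suc r} A_matrix xs (ys @ rev [k..<r + 2])"
    using A_equiv_normal_form[OF Suc.prems(1)] by blast
  have id: "word_perm ys \<circ> word_perm (rev [k..<r + 2]) = id"
    using word_perm_coxeter_equiv[OF eq] Suc.prems(2) by (metis word_perm_append)
  have "word_perm ys (word_perm (rev [k..<r + 2]) k) = r + 2"
    using word_perm_run[of k "r + 2"] word_perm_fixes_above[OF ys(1), of "r + 2"] ys(2) by auto
  then have k: "k = r + 2" using id by (metis comp_apply id_apply)
  then have "coxeter_equiv {1..r} A_matrix ys []" using id Suc.IH[OF ys(1)] by simp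
  then have "coxeter_equiv {1..Suc r} A_matrix ys []"
    by (rule coxeter_equiv_mono) auto
  then show ?case using coxeter_equiv.trans[OF eq] k by simp
qed

text \<open>Generators are self-inverse, so \<open>rev ys\<close> represents the inverse of
  \<open>ys\<close>, and the claim reduces to the trivially acting word
  \<open>rev ys @ xs\<close>.\<close>

lemma word_perm_eq_iff:
  assumes "xs \<in> lists {1..r}" "ys \<in> lists {1..r}"
  shows "word_perm xs = word_perm ys \<longleftrightarrow> coxeter_equiv {1..r} A_matrix xs ys"
proof
  let ?E = "coxeter_equiv {1..r} A_matrix"
  assume eq: "word_perm xs = word_perm ys"
  have rev: "rev ys \<in> lists {1..r}" using assms by auto
  have "?E (rev ys @ ys) []" "?E (ys @ rev ys) []"
    using coxeter_rev_left_inverse[of "{1..r}" A_matrix ys] assms(2)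
      coxeter_rev_left_inverse[of "{1..r}" A_matrix "rev ys"] rev
    by (simp_all add: A_matrix_def)
  moreover from this(1) have "word_perm (rev ys @ xs) = id"
    using word_perm_coxeter_equiv eq by (fastforce simp: word_perm_append)
  then have "?E (rev ys @ xs) []"
    using assms rev by (intro word_perm_eq_id_imp_equiv) auto
  ultimately have "?E (ys @ (rev ys @ xs)) (ys @ [])" "?E ((ys @ rev ys) @ xs) ([] @ xs)"
    using assms by (blast intro: coxeter_equiv_append_left coxeter_equiv_append_right)+
  then show "?E xs ys"
    by (simp only: append_assoc append_Nil append_Nil2) (metis coxeter_equiv.sym coxeter_equiv.trans)
qed (rule word_perm_coxeter_equiv)

section \<open>Young subgroups and inversions\<close>

text \<open>For \<open>I = {1..r}\<close> these are the permutations of \<open>{1..r + 1}\<close>.\<close>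

definition young :: "nat set \<Rightarrow> (nat \<Rightarrow> nat) set" where
  "young I = {f. bij f \<and> (\<forall>t. t \<notin> I \<longrightarrow> (\<forall>i. f i \<le> t \<longleftrightarrow> i \<le> t))}"

text \<open>HOL-Algebra reuses the prefix \<open>inv\<close> for inverses in a group.\<close>

abbreviation fun_inv :: "('a \<Rightarrow> 'b) \<Rightarrow> 'b \<Rightarrow> 'a" where
  "fun_inv \<equiv> inv_into UNIV"

lemma youngD: "f \<in> young I \<Longrightarrow> t \<notin> I \<Longrightarrow> f i \<le> t \<longleftrightarrow> i \<le> t"
  by (auto simp: young_def)

lemma young_bij: "f \<in> young I \<Longrightarrow> bij f"
  by (auto simp: young_def)

lemma young_mono: "I \<subseteq> J \<Longrightarrow> young I \<subseteq> young J"
  by (auto simp: young_def)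

lemma young_id: "id \<in> young I"
  by (simp add: young_def)

lemma young_comp: "f \<in> young I \<Longrightarrow> g \<in> young I \<Longrightarrow> f \<circ> g \<in> young I"
  by (auto simp: young_def bij_comp)

lemma young_inv:
  assumes "f \<in> young I"
  shows "fun_inv f \<in> young I"
proof -
  have f: "bij f" using assms by (rule young_bij)
  have "fun_inv f i \<le> t \<longleftrightarrow> i \<le> t" if "t \<notin> I" for t i
    using youngD[OF assms that, of "fun_inv f i"] f by (simp add: bij_is_surj surj_f_inv_f)
  then show ?thesis using bij_imp_bij_inv[OF f] by (simp add: young_def)
qed

lemma young_transpose: "i \<in> I \<Longrightarrow> transpose i (Suc i) \<in> young I"
  by (auto simp: young_def transpose_def Suc_le_eq order_le_less)

lemma young_word_perm: "xs \<in> lists I \<Longrightarrow> word_perm xs \<in> young I"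
  by (induction xs) (auto simp: young_id intro!: young_comp young_transpose)

lemma young_permutes:
  assumes "f \<in> young {1..r}"
  shows "f permutes {1..Suc r}"
proof -
  have "f i = i" if "i \<notin> {1..Suc r}" for i
  proof (cases "i = 0")
    case True
    then show ?thesis using youngD[OF assms, of 0 i] by simp
  next
    case False
    then show ?thesis
      using youngD[OF assms, of i i] youngD[OF assms, of "i - 1" i] that by fastforce
  qed
  then show ?thesis using young_bij[OF assms] unfolding permutes_def bij_iff by blast
qed

lemma permutes_young:
  assumes "f permutes {1..Suc r}"
  shows "f \<in> young {1..r}"
proof -
  have "f i \<le> t \<longleftrightarrow> i \<le> t" if "t \<notin> {1..r}" for t i
    using permutes_in_image[OF assms, of i] permutes_not_in[OF assms, of i] that by fastforce
  then show ?thesis using permutes_bij[OF assms] by (simp add: young_def)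
qed

text \<open>A strictly increasing map on the naturals lies above the identity; this applies to
  \<open>f\<close> and to its inverse. It recognizes the identity as the permutation without
  descents.\<close>

lemma strict_mono_bij_nat:
  fixes f :: "nat \<Rightarrow> nat"
  assumes "bij f" "strict_mono f"
  shows "f = id"
proof
  fix i
  have "strict_mono (fun_inv f)"
  proof (rule strict_monoI)
    fix a b :: nat assume "a < b"
    moreover have "f (fun_inv f c) = c" for c
      using assms(1) by (simp add: bij_is_surj surj_f_inv_f)
    ultimately show "fun_inv f a < fun_inv f b"
      using strict_mono_less[OF assms(2), of "fun_inv f a" "fun_inv f b"] by simp
  qed
  then have "f i \<le> fun_inv f (f i)" by (rule strict_mono_imp_increasing)
  moreover have "i \<le> f i" using assms(2) by (rule strict_mono_imp_increasing)
  ultimately show "f i = id i" using assms(1) by (simp add: bij_is_inj)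
qed

section \<open>Inversions and word length\<close>

definition inversions :: "(nat \<Rightarrow> nat) \<Rightarrow> (nat \<times> nat) set" where
  "inversions f = {(i, j). i < j \<and> f j < f i}"

text \<open>If \<open>t\<close> is outside \<open>I\<close>, then \<open>f\<close> preserves the
  points up to \<open>t\<close>, so a pair separated by \<open>t\<close> keeps its order.\<close>

lemma inversions_subset:
  assumes "f \<in> young I"
  shows "inversions f \<subseteq> {(i, j). i < j \<and> {i..<j} \<subseteq> I}"
proof clarify
  fix i j assume "(i, j) \<in> inversions f"
  then have ij: "i < j" "f j < f i" by (auto simp: inversions_def)
  moreover have "t \<in> I" if "t \<in> {i..<j}" for t
    using youngD[OF assms, of t i] youngD[OF assms, of t j] ij that by fastforce
  ultimately show "i < j \<and> {i..<j} \<subseteq> I" by blast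
qed

lemma finite_pairs_within:
  fixes I :: "nat set"
  assumes "finite I"
  shows "finite {(i, j). i < j \<and> {i..<j} \<subseteq> I}"
proof (rule finite_subset)
  show "{(i, j). i < j \<and> {i..<j} \<subseteq> I} \<subseteq> I \<times> Suc ` I"
  proof clarify
    fix i j :: nat assume ij: "i < j" "{i..<j} \<subseteq> I"
    then have "i \<in> I" "j - 1 \<in> I" "j = Suc (j - 1)" by auto
    then show "i \<in> I \<and> j \<in> Suc ` I" by blast
  qed
qed (use assms in simp)

lemma finite_inversions: "f \<in> young I \<Longrightarrow> finite I \<Longrightarrow> finite (inversions f)"
  by (rule finite_subset[OF inversions_subset finite_pairs_within])

text \<open>Exchanging the positions \<open>i\<close> and \<open>Suc i\<close> alters the relative
  order of no other pair of positions. Hence one letter changes the number of inversions by exactly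
  one, according to whether this pair is inverted.\<close>

lemma inversions_transpose:
  fixes i :: nat
  defines "s \<equiv> transpose i (Suc i)"
  shows "inversions (f \<circ> s) - {(i, Suc i)} = map_prod s s ` (inversions f - {(i, Suc i)})"
proof -
  have ord: "s a < s b \<and> (s a, s b) \<noteq> (i, Suc i) \<longleftrightarrow> a < b \<and> (a, b) \<noteq> (i, Suc i)" for a b
    unfolding s_def transpose_def prod.inject by presburger
  have ss: "s (s a) = a" for a by (simp add: s_def)
  have inj: "inj (map_prod s s)" by (intro prod.inj_map) (simp_all add: s_def)
  have R: "(a, b) \<in> inversions (f \<circ> s) - {(i, Suc i)}
      \<longleftrightarrow> (s a, s b) \<in> inversions f - {(i, Suc i)}" for a b
    using ord[of a b] unfolding inversions_def Diff_iff singleton_iff mem_Collect_eq case_prod_conv comp_apply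
    by argo
  have "p \<in> inversions (f \<circ> s) - {(i, Suc i)}
      \<longleftrightarrow> p \<in> map_prod s s ` (inversions f - {(i, Suc i)})" for p
  proof (cases p)
    case (Pair a b)
    have "p \<in> map_prod s s ` A \<longleftrightarrow> (s a, s b) \<in> A" for A
      using inj_image_mem_iff[OF inj, of "(s a, s b)" A] by (simp add: ss Pair)
    then show ?thesis using R[of a b] unfolding Pair by simp
  qed
  then show ?thesis unfolding set_eq_iff by (rule allI)
qed

lemma card_inversions_transpose:
  assumes "f \<in> young I" "finite I" "i \<in> I" "f (Suc i) < f i"
  shows "card (inversions f) = Suc (card (inversions (f \<circ> transpose i (Suc i))))"
proof -
  let ?s = "transpose i (Suc i)"
  have inj: "inj_on (map_prod ?s ?s) A" for A
    by (intro inj_on_subset[OF prod.inj_map]) auto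
  have mem: "(i, Suc i) \<in> inversions f" "(i, Suc i) \<notin> inversions (f \<circ> ?s)"
    using assms(4) by (auto simp: inversions_def)
  have "card (inversions (f \<circ> ?s)) = card (inversions f - {(i, Suc i)})"
    using inversions_transpose[of f i] mem(2) card_image[OF inj] by simp
  then show ?thesis
    using mem(1) finite_inversions[OF assms(1,2)] card_Suc_Diff1 by metis
qed

lemma card_inversions_word_perm:
  assumes "finite I" "xs \<in> lists I"
  shows "card (inversions (word_perm xs)) \<le> length xs"
  using assms(2)
proof (induction xs rule: rev_induct)
  case Nil
  have "inversions id = {}" by (auto simp: inversions_def)
  then show ?case by (simp only: word_perm.simps card.empty le0)
next
  case (snoc i xs)
  let ?f = "word_perm xs" and ?s = "transpose i (Suc i)"
  have i: "i \<in> I" and xs: "xs \<in> lists I" using snoc.prems by auto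
  have f: "?f \<in> young I" "?f \<circ> ?s \<in> young I"
    using young_word_perm[OF xs] young_comp[OF _ young_transpose[OF i]] by auto
  have "?f i \<noteq> ?f (Suc i)" by (simp add: inj_eq[OF bij_is_inj[OF bij_word_perm]])
  then consider "?f (Suc i) < ?f i" | "?f i < ?f (Suc i)" by linarith
  then have "card (inversions (?f \<circ> ?s)) \<le> Suc (card (inversions ?f))"
  proof cases
    case 1
    then show ?thesis using card_inversions_transpose[OF f(1) assms(1) i] by simp
  next
    case 2
    then show ?thesis using card_inversions_transpose[OF f(2) assms(1) i] by (simp add: comp_assoc)
  qed
  moreover have "word_perm (xs @ [i]) = ?f \<circ> ?s" by (simp add: word_perm_append fun_eq_iff)
  ultimately show ?case using snoc.IH[OF xs] by (simp only: length_append_singleton)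
qed

text \<open>Bubble sort: a descent at \<open>i\<close> is removed by the letter \<open>i\<close>,
  which lowers the number of inversions by one. Descents occur only inside \<open>I\<close>, since
  \<open>f i \<le> i < f (Suc i)\<close> outside it; the word therefore stays in the parabolic
  subgroup and has minimal length.\<close>

lemma ex_sorting_word:
  assumes "finite I" "f \<in> young I"
  shows "\<exists>xs\<in>lists I. word_perm xs = f \<and> length xs = card (inversions f)"
  using assms(2)
proof (induction "card (inversions f)" arbitrary: f)
  case 0
  have "f i < f (Suc i)" for i
  proof -
    have "inversions f = {}" using 0 finite_inversions assms(1) by auto
    then have "\<not> f (Suc i) < f i" by (auto simp: inversions_def)
    moreover have "f i \<noteq> f (Suc i)" by (simp add: inj_eq[OF bij_is_inj[OF young_bij[OF 0(2)]]])
    ultimately show ?thesis by linarith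
  qed
  then have "f = id"
    using young_bij[OF 0(2)] by (intro strict_mono_bij_nat) (auto simp: strict_mono_Suc_iff)
  then have "[] \<in> lists I \<and> word_perm [] = f \<and> length [] = card (inversions f)"
    using 0(1) by (simp only: word_perm.simps list.size lists.Nil)
  then show ?case by blast
next
  case (Suc k)
  have "\<exists>i\<in>I. f (Suc i) < f i"
  proof (rule ccontr)
    assume neg: "\<not> ?thesis"
    have "f i < f (Suc i)" for i
    proof (cases "i \<in> I")
      case True
      moreover have "f i \<noteq> f (Suc i)"
        by (simp add: inj_eq[OF bij_is_inj[OF young_bij[OF Suc(3)]]])
      ultimately show ?thesis using neg by (meson linorder_neqE_nat)
    next
      case False
      then show ?thesis
        using youngD[OF Suc(3), of i i] youngD[OF Suc(3), of i "Suc i"] by linarith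
    qed
    then have "f = id"
      using young_bij[OF Suc(3)] by (intro strict_mono_bij_nat) (auto simp: strict_mono_Suc_iff)
    then have "inversions f = {}" by (auto simp: inversions_def)
    then show False using Suc(2) by simp
  qed
  then obtain i where i: "i \<in> I" "f (Suc i) < f i" by blast
  let ?s = "transpose i (Suc i)"
  have fs: "f \<circ> ?s \<in> young I" using young_comp[OF Suc(3) young_transpose[OF i(1)]] .
  have k: "k = card (inversions (f \<circ> ?s))"
    using card_inversions_transpose[OF Suc(3) assms(1) i] Suc(2) by simp
  obtain xs where xs: "xs \<in> lists I" "word_perm xs = f \<circ> ?s" "length xs = k"
    using Suc(1)[OF k fs] k by auto
  have "word_perm (xs @ [i]) = f" by (simp add: word_perm_append xs(2) comp_assoc)
  moreover have "length (xs @ [i]) = card (inversions f)" using xs(3) Suc(2) by simp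
  moreover have "xs @ [i] \<in> lists I" using xs(1) i(1) by simp
  ultimately show ?case by blast
qed

text \<open>The inversion set and the order of the positions together decide every comparison of
  values, so \<open>f\<close> composed with the inverse of \<open>g\<close> is strictly
  increasing.\<close>

lemma inversions_inject:
  assumes "bij f" "bij g" "inversions f = inversions g"
  shows "f = g"
proof -
  let ?h = "f \<circ> fun_inv g"
  have *: "f a < f b" if "g a < g b" for a b
  proof -
    have "a \<noteq> b" using that by auto
    then have "f a \<noteq> f b" by (simp add: inj_eq[OF bij_is_inj[OF assms(1)]])
    show ?thesis
    proof (cases "a < b")
      case True
      then have "(a, b) \<notin> inversions g" using that by (auto simp: inversions_def)
      then show ?thesis using assms(3) True \<open>f a \<noteq> f b\<close> by (auto simp: inversions_def)
    next
      case False
      then have "(b, a) \<in> inversions g" using that \<open>a \<noteq> b\<close> by (auto simp: inversions_def)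
      then show ?thesis using assms(3) by (auto simp: inversions_def)
    qed
  qed
  have "g (fun_inv g x) = x" for x using assms(2) by (simp add: bij_is_surj surj_f_inv_f)
  then have "strict_mono ?h" by (auto simp: strict_mono_def intro: *)
  moreover have "bij ?h" using assms by (simp add: bij_comp bij_imp_bij_inv)
  ultimately have "?h = id" by (intro strict_mono_bij_nat)
  then have "f \<circ> (fun_inv g \<circ> g) = g" by (simp add: comp_assoc[symmetric])
  then show ?thesis using assms(2) by (simp add: bij_is_inj)
qed

section \<open>The Coxeter group of type A as a permutation group\<close>

text \<open>Elements of the group are sets of words; as the action is faithful, each is a full fibre
  of \<open>word_perm\<close>, and the isomorphism with permutations becomes an equality of
  sets.\<close>

definition perm_class :: "nat \<Rightarrow> (nat \<Rightarrow> nat) \<Rightarrow> nat list set" where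
  "perm_class r f = {xs \<in> lists {1..r}. word_perm xs = f}"

lemma coxeter_rel_image:
  assumes "xs \<in> lists {1..r}"
  shows "coxeter_rel {1..r} A_matrix `` {xs} = perm_class r (word_perm xs)"
proof -
  have "coxeter_equiv {1..r} A_matrix xs ys \<longleftrightarrow> ys \<in> lists {1..r} \<and> word_perm ys = word_perm xs" for ys
    using coxeter_equiv_lists[of "{1..r}" A_matrix xs ys] word_perm_eq_iff[OF assms, of ys] by metis
  then show ?thesis unfolding perm_class_def coxeter_rel_def by blast
qed

lemma young_word:
  assumes "f \<in> young {1..r}"
  obtains xs where "xs \<in> lists {1..r}" "word_perm xs = f"
  using ex_sorting_word[OF finite_atLeastAtMost assms] by blast

lemma perm_class_eq_iff:
  assumes "f \<in> young {1..r}"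
  shows "perm_class r f = perm_class r g \<longleftrightarrow> f = g"
proof
  obtain xs where "xs \<in> lists {1..r}" "word_perm xs = f" by (rule young_word[OF assms])
  then have xs: "xs \<in> perm_class r f" unfolding perm_class_def by blast
  assume "perm_class r f = perm_class r g"
  with xs have "xs \<in> perm_class r g" by simp
  with xs show "f = g" unfolding perm_class_def by blast
qed simp

lemma carrier_A_group: "carrier (A_group r) = perm_class r ` young {1..r}"
proof -
  have "carrier (A_group r) = (\<lambda>xs. coxeter_rel {1..r} A_matrix `` {xs}) ` lists {1..r}"
    unfolding coxeter_group_def quotient_def by auto
  also have "\<dots> = (\<lambda>xs. perm_class r (word_perm xs)) ` lists {1..r}"
    by (rule image_cong[OF HOL.refl coxeter_rel_image])
  also have "\<dots> = perm_class r ` word_perm ` lists {1..r}"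
    by (simp only: image_image)
  also have "word_perm ` lists {1..r} = young {1..r}"
  proof
    show "young {1..r} \<subseteq> word_perm ` lists {1..r}"
    proof
      fix f assume "f \<in> young {1..r}"
      then obtain xs where "xs \<in> lists {1..r}" "word_perm xs = f" by (rule young_word)
      then show "f \<in> word_perm ` lists {1..r}" by blast
    qed
  qed (rule image_subsetI[OF young_word_perm])
  finally show ?thesis .
qed

lemma perm_class_mult:
  assumes "f \<in> young {1..r}" "g \<in> young {1..r}"
  shows "perm_class r f \<otimes>\<^bsub>A_group r\<^esub> perm_class r g = perm_class r (f \<circ> g)"
proof -
  obtain xs ys where xs: "xs \<in> lists {1..r}" "word_perm xs = f"
    and ys: "ys \<in> lists {1..r}" "word_perm ys = g"
    using young_word[OF assms(1)] young_word[OF assms(2)] by metis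
  then have "xs @ ys \<in> lists {1..r}" by simp
  then show ?thesis
    using coxeter_mult_class[OF xs(1) ys(1), of A_matrix]
    by (simp only: coxeter_rel_image xs ys word_perm_append)
qed

lemma perm_class_one: "\<one>\<^bsub>A_group r\<^esub> = perm_class r id"
  using coxeter_rel_image[of "[]" r] by (simp only: coxeter_group_def word_perm.simps lists.Nil monoid.simps)

lemma perm_class_inv:
  assumes "f \<in> young {1..r}"
  shows "inv\<^bsub>A_group r\<^esub> (perm_class r f) = perm_class r (fun_inv f)"
proof (rule group.inv_equality[OF group_A_group])
  have "fun_inv f \<circ> f = id" using young_bij[OF assms] by (simp add: bij_is_inj)
  then show "perm_class r (fun_inv f) \<otimes>\<^bsub>A_group r\<^esub> perm_class r f = \<one>\<^bsub>A_group r\<^esub>"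
    by (simp only: perm_class_mult[OF young_inv[OF assms] assms] perm_class_one)
qed (use assms young_inv[OF assms] carrier_A_group in blast)+

lemma coxeter_length_perm_class:
  assumes "f \<in> young {1..r}"
  shows "coxeter_length (perm_class r f) = card (inversions f)"
  unfolding coxeter_length_def
proof (rule Least_equality)
  show "\<exists>xs\<in>perm_class r f. length xs = card (inversions f)"
    using ex_sorting_word[OF finite_atLeastAtMost assms] unfolding perm_class_def by blast
next
  fix k assume "\<exists>xs\<in>perm_class r f. length xs = k"
  then show "card (inversions f) \<le> k"
    using card_inversions_word_perm[of "{1..r}"] unfolding perm_class_def by blast
qed

lemma simple_gen_perm_class:
  assumes "i \<in> {1..r}"
  shows "simple_gen {1..r} A_matrix i = perm_class r (transpose i (Suc i))"
proof -
  have "[i] \<in> lists {1..r}" using assms by simp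
  from coxeter_rel_image[OF this] show ?thesis by (simp only: simple_gen_def word_perm.simps o_id)
qed

lemma parabolic_perm_class:
  assumes "I \<subseteq> {1..r}"
  shows "parabolic {1..r} A_matrix I = perm_class r ` young I"
proof
  let ?G = "A_group r" and ?gens = "simple_gen {1..r} A_matrix ` I"
  have sub: "f \<in> young {1..r}" if "f \<in> young I" for f
    using young_mono[OF assms] that by blast
  have gen: "x \<in> perm_class r ` young I" if "x \<in> ?gens" for x
    using that assms simple_gen_perm_class young_transpose by blast
  show "parabolic {1..r} A_matrix I \<subseteq> perm_class r ` young I"
  proof
    fix x assume "x \<in> parabolic {1..r} A_matrix I"
    then have "x \<in> generate ?G ?gens" by (simp add: parabolic_def)
    then show "x \<in> perm_class r ` young I"
    proof (induction rule: generate.induct)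
      case one
      then show ?case using young_id perm_class_one by blast
    next
      case (incl x)
      then show ?case by (rule gen)
    next
      case (inv x)
      then obtain f where "f \<in> young I" "x = perm_class r f" using gen by blast
      then show ?case using perm_class_inv[OF sub] young_inv by blast
    next
      case (eng x y)
      then obtain f g where "f \<in> young I" "x = perm_class r f" "g \<in> young I" "y = perm_class r g"
        by blast
      then show ?case using perm_class_mult[OF sub sub] young_comp by blast
    qed
  qed
  \<comment> \<open>For the converse inclusion it suffices to treat words over \<open>I\<close>: a
    sorting word of an element of \<open>young I\<close> uses no other letters.\<close>
  have "perm_class r (word_perm xs) \<in> generate ?G ?gens" if "xs \<in> lists I" for xs
    using that
  proof (induction xs)
    case Nil
    then show ?case using generate.one[of ?G ?gens] by (simp only: word_perm.simps perm_class_one)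
  next
    case (Cons i xs)
    have i: "i \<in> {1..r}" using Cons.hyps assms by blast
    have "perm_class r (transpose i (Suc i)) \<in> generate ?G ?gens"
      using Cons.hyps(1) simple_gen_perm_class[OF i] by (metis generate.incl imageI)
    then show ?case
      using Cons.IH perm_class_mult[OF young_transpose[OF i] sub[OF young_word_perm[OF Cons.hyps(2)]]]
      by (metis generate.eng word_perm.simps(2))
  qed
  moreover have "finite I" using assms finite_subset by blast
  ultimately show "perm_class r ` young I \<subseteq> parabolic {1..r} A_matrix I"
    unfolding parabolic_def using ex_sorting_word by blast
qed

section \<open>Longest elements of parabolic subgroups\<close>

text \<open>Since \<open>c\<close> inverts every pair that an element of \<open>young I\<close> can
  invert, its length is maximal. Another element of that length has the same finite inversion set
  and so equals \<open>c\<close>.\<close>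

lemma A_longest_eqI:
  assumes "I \<subseteq> {1..r}" "c \<in> young I"
    and rev: "\<And>i j. i < j \<Longrightarrow> {i..<j} \<subseteq> I \<Longrightarrow> c j < c i"
  shows "A_longest r I = perm_class r c"
proof -
  let ?P = "{(i, j). i < j \<and> {i..<j} \<subseteq> I}"
  have fin: "finite I" using assms(1) finite_subset by blast
  have sub: "f \<in> young {1..r}" if "f \<in> young I" for f
    using young_mono[OF assms(1)] that by blast
  note len = coxeter_length_perm_class[OF sub]
  have inv_c: "inversions c = ?P"
    using inversions_subset[OF assms(2)] rev by (auto simp: inversions_def)
  have le: "card (inversions f) \<le> card (inversions c)" if "f \<in> young I" for f
    unfolding inv_c by (rule card_mono[OF finite_pairs_within[OF fin] inversions_subset[OF that]])
  show ?thesis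
    unfolding longest_elt_def parabolic_perm_class[OF assms(1)]
  proof (rule the_equality)
    show "perm_class r c \<in> perm_class r ` young I \<and>
      (\<forall>v\<in>perm_class r ` young I. coxeter_length v \<le> coxeter_length (perm_class r c))"
      using assms(2) le len by auto
  next
    fix w assume w: "w \<in> perm_class r ` young I \<and>
      (\<forall>v\<in>perm_class r ` young I. coxeter_length v \<le> coxeter_length w)"
    then obtain f where f: "f \<in> young I" "w = perm_class r f" by blast
    have "card (inversions c) \<le> card (inversions f)"
      using w f assms(2) len by auto
    then have "inversions f = inversions c"
      using inversions_subset[OF f(1)] finite_pairs_within[OF fin] unfolding inv_c
      by (intro card_subset_eq) (auto intro: antisym card_mono)
    then show "w = perm_class r c"
      using inversions_inject young_bij f assms(2) by blast
  qed
qed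

section \<open>Pairs of commuting involutions\<close>

definition commuting_invols :: "'a set \<Rightarrow> ('a \<Rightarrow> 'a) \<Rightarrow> ('a \<Rightarrow> 'a) \<Rightarrow> bool" where
  "commuting_invols X b x \<longleftrightarrow>
     (\<forall>p\<in>X. b p \<in> X \<and> x p \<in> X \<and> b (b p) = p \<and> x (x p) = p \<and> b (x p) = x (b p))"

text \<open>For commuting involutions \<open>b\<close> and \<open>x\<close> the type of a point is its stabilizer in the Klein
  four-group they generate, hence constant on orbits.\<close>

definition orbit_type :: "('a \<Rightarrow> 'a) \<Rightarrow> ('a \<Rightarrow> 'a) \<Rightarrow> 'a \<Rightarrow> bool \<times> bool \<times> bool" where
  "orbit_type b x p = (b p = p, x p = p, x p = b p)"

text \<open>The images of \<open>p\<close> under the four elements of the Klein group. Coincidences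
  are allowed, so the set has one, two or four elements.\<close>

definition four_orbit :: "('a \<Rightarrow> 'a) \<Rightarrow> ('a \<Rightarrow> 'a) \<Rightarrow> 'a \<Rightarrow> 'a set" where
  "four_orbit b x p = {p, b p, x p, x (b p)}"

lemma commuting_involsD:
  assumes "commuting_invols X b x" "p \<in> X"
  shows "b p \<in> X" "x p \<in> X" "b (b p) = p" "x (x p) = p" "b (x p) = x (b p)"
  using assms by (auto simp: commuting_invols_def)

lemma orbit_type_step:
  assumes "commuting_invols X b x" "p \<in> X"
  shows "orbit_type b x (b p) = orbit_type b x p" "orbit_type b x (x p) = orbit_type b x p"
proof -
  note p = commuting_involsD[OF assms]
  have "x (b p) = b p \<longleftrightarrow> x p = p" "x (b p) = p \<longleftrightarrow> x p = b p"
    "b (x p) = x p \<longleftrightarrow> b p = p" "p = b (x p) \<longleftrightarrow> x p = b p"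
    using p commuting_involsD[OF assms(1) p(1)] commuting_involsD[OF assms(1) p(2)] by metis+
  then show "orbit_type b x (b p) = orbit_type b x p" "orbit_type b x (x p) = orbit_type b x p"
    unfolding orbit_type_def prod.inject p(3,4) by auto
qed

lemma four_orbit_closed:
  assumes "commuting_invols X b x" "p \<in> X" "z \<in> four_orbit b x p"
  shows "z \<in> X" "b z \<in> four_orbit b x p" "x z \<in> four_orbit b x p"
    "orbit_type b x z = orbit_type b x p"
proof -
  note p = commuting_involsD[OF assms(1,2)]
  note bp = commuting_involsD[OF assms(1) p(1)] and xp = commuting_involsD[OF assms(1) p(2)]
  have z: "z = p \<or> z = b p \<or> z = x p \<or> z = x (b p)"
    using assms(3) by (auto simp: four_orbit_def)
  show "z \<in> X" using z assms(2) p bp by auto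
  show "b z \<in> four_orbit b x p" "x z \<in> four_orbit b x p"
    using z p bp xp by (auto simp: four_orbit_def)
  show "orbit_type b x z = orbit_type b x p"
    using z orbit_type_step[OF assms(1,2)] orbit_type_step(2)[OF assms(1) p(1)] by auto
qed

lemma commuting_invols_Diff:
  assumes "commuting_invols X b x" "p \<in> X"
  shows "commuting_invols (X - four_orbit b x p) b x"
proof -
  note closed = four_orbit_closed[OF assms] and inv = commuting_involsD[OF assms(1)]
  have "b z \<notin> four_orbit b x p" "x z \<notin> four_orbit b x p"
    if "z \<in> X" "z \<notin> four_orbit b x p" for z
    using closed(2)[of "b z"] closed(3)[of "x z"] inv(3,4)[OF that(1)] that(2) by auto
  then show ?thesis using inv unfolding commuting_invols_def by blast
qed

lemma card_type_Diff:
  assumes "commuting_invols X b x" "p \<in> X" "finite X"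
  shows "card {z \<in> X - four_orbit b x p. orbit_type b x z = t} =
    card {z \<in> X. orbit_type b x z = t} -
      (if t = orbit_type b x p then card (four_orbit b x p) else 0)"
proof (cases "t = orbit_type b x p")
  case True
  note closed = four_orbit_closed[OF assms(1,2)]
  have "{z \<in> X - four_orbit b x p. orbit_type b x z = t}
      = {z \<in> X. orbit_type b x z = t} - four_orbit b x p" by blast
  moreover have "four_orbit b x p \<subseteq> {z \<in> X. orbit_type b x z = t}"
    using closed(1,4) True by blast
  moreover have "finite (four_orbit b x p)" by (simp add: four_orbit_def)
  ultimately show ?thesis using True by (simp add: card_Diff_subset)
next
  case False
  then have "{z \<in> X - four_orbit b x p. orbit_type b x z = t} = {z \<in> X. orbit_type b x z = t}"
    using four_orbit_closed(4)[OF assms(1,2)] by blast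
  then show ?thesis using False by simp
qed

text \<open>Orbits with the same stabilizer are isomorphic: the image of \<open>p\<close> under a
  group element goes to the image of \<open>q\<close> under the same element.\<close>

lemma four_orbit_bij:
  assumes X: "commuting_invols X b x" "p \<in> X" and Y: "commuting_invols Y b' y" "q \<in> Y"
    and type: "orbit_type b x p = orbit_type b' y q"
  obtains h where "bij_betw h (four_orbit b x p) (four_orbit b' y q)"
    "\<And>z. z \<in> four_orbit b x p \<Longrightarrow> h (b z) = b' (h z) \<and> h (x z) = y (h z)"
proof -
  note p = commuting_involsD[OF X]
  note bp = commuting_involsD[OF X(1) p(1)] and xp = commuting_involsD[OF X(1) p(2)]
  note q = commuting_involsD[OF Y]
  note bq = commuting_involsD[OF Y(1) q(1)] and yq = commuting_involsD[OF Y(1) q(2)]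
  have t: "b p = p \<longleftrightarrow> b' q = q" "x p = p \<longleftrightarrow> y q = q" "x p = b p \<longleftrightarrow> y q = b' q"
    using type by (auto simp: orbit_type_def)
  have tx: "x (b p) = p \<longleftrightarrow> x p = b p" "x (b p) = b p \<longleftrightarrow> x p = p" "x (b p) = x p \<longleftrightarrow> b p = p"
    using p bp xp by metis+
  have ty: "y (b' q) = q \<longleftrightarrow> y q = b' q" "y (b' q) = b' q \<longleftrightarrow> y q = q" "y (b' q) = y q \<longleftrightarrow> b' q = q"
    using q bq yq by metis+
  define h where
    "h z = (if z = p then q else if z = b p then b' q else if z = x p then y q else y (b' q))" for z
  \<comment> \<open>The branches of \<open>h\<close> overlap when images of \<open>p\<close>
    coincide. All coincidences with \<open>x (b p)\<close> reduce to the three recorded in the type,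
    and these hold for \<open>q\<close> as well, so \<open>h\<close> is well defined.\<close>
  have h: "h p = q" "h (b p) = b' q" "h (x p) = y q" "h (x (b p)) = y (b' q)"
    by (simp_all add: h_def tx t) (metis ty)
  have "inj_on h (four_orbit b x p)"
    unfolding inj_on_def four_orbit_def by (simp only: ball_simps h simp_thms) (metis t tx ty)
  moreover have "h ` four_orbit b x p = four_orbit b' y q"
    by (simp only: four_orbit_def image_insert image_empty h)
  moreover have "h (b z) = b' (h z) \<and> h (x z) = y (h z)" if "z \<in> four_orbit b x p" for z
  proof -
    have "z = p \<or> z = b p \<or> z = x p \<or> z = x (b p)" using that by (simp add: four_orbit_def)
    then show ?thesis
      by (elim disjE) (simp_all only: h p(3-5) bp(3-5) q(3-5) bq(3-5) simp_thms)
  qed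
  ultimately show ?thesis using that unfolding bij_betw_def by blast
qed

text \<open>One orbit is matched and removed on each side at a time. Counting points instead of
  orbits is harmless, because matched orbits have the same size and so the counts stay
  equal.\<close>

lemma ex_equivariant_bij:
  assumes "finite X" "finite Y" "commuting_invols X b x" "commuting_invols Y b' y"
    and "\<And>t. card {p \<in> X. orbit_type b x p = t} = card {q \<in> Y. orbit_type b' y q = t}"
  shows "\<exists>h. bij_betw h X Y \<and> (\<forall>p\<in>X. h (b p) = b' (h p) \<and> h (x p) = y (h p))"
  using assms
proof (induction X arbitrary: Y rule: finite_psubset_induct)
  case (psubset X)
  note X = psubset.prems(2) and Y = psubset.prems(3) and count = psubset.prems(4)
  show ?case
  proof (cases "X = {}")
    case True
    have "Y = {}"
    proof (rule ccontr)
      assume "Y \<noteq> {}"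
      then obtain q where "q \<in> Y" by blast
      then have "card {z \<in> Y. orbit_type b' y z = orbit_type b' y q} \<noteq> 0"
        using psubset.prems(1) by auto
      then show False using count[of "orbit_type b' y q"] True by simp
    qed
    then show ?thesis using True by (auto simp: bij_betw_def)
  next
    case False
    then obtain p where p: "p \<in> X" by blast
    then have "card {z \<in> X. orbit_type b x z = orbit_type b x p} \<noteq> 0"
      using psubset.hyps by auto
    then have "{z \<in> Y. orbit_type b' y z = orbit_type b x p} \<noteq> {}"
      using count[of "orbit_type b x p"] by (metis card.empty)
    then obtain q where q: "q \<in> Y" and type: "orbit_type b x p = orbit_type b' y q"
      by (metis (mono_tags, lifting) Collect_empty_eq)
    let ?O = "four_orbit b x p" and ?O' = "four_orbit b' y q"
    obtain g where g: "bij_betw g ?O ?O'"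
      "\<And>z. z \<in> ?O \<Longrightarrow> g (b z) = b' (g z) \<and> g (x z) = y (g z)"
      using four_orbit_bij[OF X p Y q type] by blast
    note closed = four_orbit_closed[OF X p] and X' = commuting_invols_Diff[OF X p]
    have sub: "?O \<subseteq> X" "?O' \<subseteq> Y"
      using closed(1) four_orbit_closed(1)[OF Y q] by auto
    have "\<exists>h. bij_betw h (X - ?O) (Y - ?O') \<and>
      (\<forall>p\<in>X - ?O. h (b p) = b' (h p) \<and> h (x p) = y (h p))"
    proof (rule psubset.IH)
      show "X - ?O \<subset> X" using p by (auto simp: four_orbit_def)
      show "card {z \<in> X - ?O. orbit_type b x z = t} = card {z \<in> Y - ?O'. orbit_type b' y z = t}" for t
        unfolding card_type_Diff[OF X p psubset.hyps] card_type_Diff[OF Y q psubset.prems(1)]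
        using count[of t] type bij_betw_same_card[OF g(1)] by simp
    qed (use psubset.prems(1) X' commuting_invols_Diff[OF Y q] in auto)
    then obtain h where h: "bij_betw h (X - ?O) (Y - ?O')"
      "\<And>z. z \<in> X - ?O \<Longrightarrow> h (b z) = b' (h z) \<and> h (x z) = y (h z)" by blast
    define f where "f z = (if z \<in> ?O then g z else h z)" for z
    have "bij_betw f (?O \<union> (X - ?O)) (?O' \<union> (Y - ?O'))"
      unfolding f_def by (rule bij_betw_disjoint_Un[OF g(1) h(1)]) auto
    moreover have "f (b z) = b' (f z) \<and> f (x z) = y (f z)" if "z \<in> X" for z
    proof (cases "z \<in> ?O")
      case True
      then show ?thesis using closed(2,3)[OF True] g(2)[OF True] by (simp add: f_def)
    next
      case False
      then have z: "z \<in> X - ?O" using that by simp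
      then have "b z \<notin> ?O" "x z \<notin> ?O" using commuting_involsD(1,2)[OF X' z] by auto
      then show ?thesis using h(2)[OF z] False by (simp add: f_def)
    qed
    moreover have "?O \<union> (X - ?O) = X" "?O' \<union> (Y - ?O') = Y" using sub by auto
    ultimately show ?thesis by (intro exI[of _ f]) auto
  qed
qed

lemma card_dvd_by_orbits:
  assumes "finite X" "commuting_invols X b x" "\<And>p. p \<in> X \<Longrightarrow> card (four_orbit b x p) = d"
  shows "d dvd card X"
proof -
  have "X = \<Union> (four_orbit b x ` X)"
    using four_orbit_closed(1)[OF assms(2)] by (auto simp: four_orbit_def)
  moreover have "d dvd card (\<Union> (four_orbit b x ` X))"
  proof (rule dvd_partition)
    have sub: "four_orbit b x z \<subseteq> four_orbit b x p" if "p \<in> X" "z \<in> four_orbit b x p" for p z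
      using four_orbit_closed(2,3)[OF assms(2) that(1)] that(2) by (auto simp: four_orbit_def[of b x z])
    \<comment> \<open>Closure gives only an inclusion of orbits; the common size \<open>d\<close>
      turns it into an equality.\<close>
    have eq: "four_orbit b x z = four_orbit b x p" if "p \<in> X" "z \<in> four_orbit b x p" for p z
      using sub[OF that] that assms(3) four_orbit_closed(1)[OF assms(2) that]
      by (intro card_subset_eq) (auto simp: four_orbit_def)
    show "\<forall>c1\<in>four_orbit b x ` X. \<forall>c2\<in>four_orbit b x ` X. c1 \<noteq> c2 \<longrightarrow> c1 \<inter> c2 = {}"
      using eq by blast
  qed (use assms calculation in auto)
  ultimately show ?thesis by simp
qed

section \<open>The involutions \<open>c\<^sub>k\<^sub>l\<close> as permutations\<close>

definition flip :: "nat \<Rightarrow> nat \<Rightarrow> nat" where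
  "flip n j = (if j \<in> {1..2 * n + 1} then 2 * n + 2 - j else j)"

text \<open>The middle interval of \<open>2 * l\<close> nodes moves a block of
  \<open>2 * l + 1\<close> points, centred at \<open>n + 1\<close> and thus reversed by the formula
  of the flip; for \<open>l = 0\<close> it is the centre alone. Each isolated node \<open>t\<close>
  exchanges \<open>t\<close> and \<open>t + 1\<close>. The index \<open>i\<close> starts at 0, which
  turns \<open>2 * i - 1\<close> into \<open>2 * i + 1\<close> and \<open>2 * n + 2 - 2 * i\<close>
  into \<open>2 * n - 2 * i\<close>.\<close>

definition pattern :: "nat \<Rightarrow> nat \<Rightarrow> nat \<Rightarrow> nat \<Rightarrow> nat" where
  "pattern n k l j =
     (if n - l < j \<and> j \<le> n + l + 1 then 2 * n + 2 - j
      else if \<exists>i<k. j = 2 * i + 1 \<or> j = 2 * n - 2 * i then j + 1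
      else if \<exists>i<k. j = 2 * i + 2 \<or> j = 2 * n - 2 * i + 1 then j - 1
      else j)"

lemma flip_flip: "flip n (flip n j) = j"
  by (auto simp: flip_def)

lemma flip_in_iff: "flip n j \<in> {1..2 * n + 1} \<longleftrightarrow> j \<in> {1..2 * n + 1}"
  by (auto simp: flip_def)

lemma flip_eq_self_iff: "j \<in> {1..2 * n + 1} \<Longrightarrow> flip n j = j \<longleftrightarrow> j = n + 1"
  by (auto simp: flip_def)

lemma mem_I_kl_iff:
  "t \<in> I_kl n k l \<longleftrightarrow> (\<exists>i<k. t = 2 * i + 1) \<or> (\<exists>i<k. t = 2 * n - 2 * i) \<or> n - l < t \<and> t \<le> n + l"
proof -
  have ex: "(\<exists>i. P i \<and> 1 \<le> i \<and> i \<le> k) \<longleftrightarrow> (\<exists>i<k. P (Suc i))" for P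
  proof
    assume "\<exists>i. P i \<and> 1 \<le> i \<and> i \<le> k"
    then obtain i where "P i" "1 \<le> i" "i \<le> k" by blast
    then have "P (Suc (i - 1))" "i - 1 < k" by auto
    then show "\<exists>i<k. P (Suc i)" by blast
  qed auto
  have "(\<exists>i. t = 2 * i - 1 \<and> 1 \<le> i \<and> i \<le> k) \<longleftrightarrow> (\<exists>i<k. t = 2 * i + 1)"
    using ex[of "\<lambda>i. t = 2 * i - 1"] by simp
  moreover have "(\<exists>i. t = 2 * n + 2 - 2 * i \<and> 1 \<le> i \<and> i \<le> k) \<longleftrightarrow> (\<exists>i<k. t = 2 * n - 2 * i)"
    using ex[of "\<lambda>i. t = 2 * n + 2 - 2 * i"] by simp
  ultimately show ?thesis unfolding I_kl_def by auto
qed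

lemma I_kl_subset:
  assumes "2 * k + l \<le> n"
  shows "I_kl n k l \<subseteq> {1..2 * n}"
proof
  fix t assume "t \<in> I_kl n k l"
  then consider i where "i < k" "t = 2 * i + 1" | i where "i < k" "t = 2 * n - 2 * i"
    | "n - l < t" "t \<le> n + l" unfolding mem_I_kl_iff by blast
  then show "t \<in> {1..2 * n}" using assms by cases auto
qed

lemma pattern_mid: "n - l < j \<Longrightarrow> j \<le> n + l + 1 \<Longrightarrow> pattern n k l j = 2 * n + 2 - j"
  by (simp add: pattern_def)

lemma pattern_pairs:
  assumes "2 * k + l \<le> n" "i < k"
  shows "pattern n k l (2 * i + 1) = 2 * i + 2" "pattern n k l (2 * i + 2) = 2 * i + 1"
    "pattern n k l (2 * n - 2 * i) = 2 * n - 2 * i + 1"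
    "pattern n k l (2 * n - 2 * i + 1) = 2 * n - 2 * i"
proof -
  have up: "2 * n - 2 * i = 2 * (n - i)" by simp
  have odd: "2 * a + 1 \<noteq> 2 * b" "2 * b \<noteq> 2 * a + 1" for a b :: nat by presburger+
  have mid: "\<not> (n - l < j \<and> j \<le> n + l + 1)"
    if "j \<in> {2 * i + 1, 2 * i + 2, 2 * n - 2 * i, 2 * n - 2 * i + 1}" for j
    using that assms by auto
  \<comment> \<open>The smaller point of a pair is tested first in \<open>pattern\<close>, so the
    larger point of one pair must never be the smaller point of another. Parity excludes this on the
    same side of the centre, and \<open>2 * k \<le> n\<close> across it.\<close>
  have no: "\<not> (\<exists>a<k. j = 2 * a + 1 \<or> j = 2 * n - 2 * a)"
    if "j = 2 * i + 2 \<or> j = 2 * n - 2 * i + 1" for j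
  proof
    assume "\<exists>a<k. j = 2 * a + 1 \<or> j = 2 * n - 2 * a"
    then obtain a where a: "a < k" "j = 2 * a + 1 \<or> j = 2 * n - 2 * a" by blast
    have "2 * n - 2 * a = 2 * (n - a)" by simp
    then show False
      using a that assms up odd[of a "i + 1"] odd[of "n - i" "n - a"] by auto
  qed
  show "pattern n k l (2 * i + 1) = 2 * i + 2"
    unfolding pattern_def using assms(2) mid[of "2 * i + 1"] by auto
  show "pattern n k l (2 * n - 2 * i) = 2 * n - 2 * i + 1"
    unfolding pattern_def using assms(2) mid[of "2 * n - 2 * i"] by auto
  show "pattern n k l (2 * i + 2) = 2 * i + 1"
    unfolding pattern_def using assms(2) mid[of "2 * i + 2"] no[of "2 * i + 2"] by auto
  show "pattern n k l (2 * n - 2 * i + 1) = 2 * n - 2 * i"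
    unfolding pattern_def using assms(2) mid[of "2 * n - 2 * i + 1"] no[of "2 * n - 2 * i + 1"] by auto
qed

lemma flip_pairs:
  assumes "i < n"
  shows "flip n (2 * i + 1) = 2 * n - 2 * i + 1" "flip n (2 * i + 2) = 2 * n - 2 * i"
    "flip n (2 * n - 2 * i) = 2 * i + 2" "flip n (2 * n - 2 * i + 1) = 2 * i + 1"
  using assms by (auto simp: flip_def)

text \<open>The intervals in the case \<open>fixed\<close> collect all pairs at once; the count of
  moved points relies on them.\<close>

lemma pattern_cases:
  assumes "2 * k + l \<le> n"
  obtains (mid) "n - l < j" "j \<le> n + l + 1"
    | (low1) i where "i < k" "j = 2 * i + 1"
    | (low2) i where "i < k" "j = 2 * i + 2"
    | (up1) i where "i < k" "j = 2 * n - 2 * i"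
    | (up2) i where "i < k" "j = 2 * n - 2 * i + 1"
    | (fixed) "pattern n k l j = j" "\<not> (n - l < j \<and> j \<le> n + l + 1)"
      "j \<notin> {1..2 * k}" "j \<notin> {2 * n + 2 - 2 * k..2 * n + 1}"
proof -
  have low: "\<exists>i<k. j = 2 * i + 1 \<or> j = 2 * i + 2" if "j \<in> {1..2 * k}"
  proof (intro exI conjI)
    show "(j - 1) div 2 < k" using that by auto
    show "j = 2 * ((j - 1) div 2) + 1 \<or> j = 2 * ((j - 1) div 2) + 2"
      using that unfolding atLeastAtMost_iff by presburger
  qed
  have up: "\<exists>i<k. j = 2 * n - 2 * i \<or> j = 2 * n - 2 * i + 1" if "j \<in> {2 * n + 2 - 2 * k..2 * n + 1}"
  proof (intro exI conjI)
    show "(2 * n + 1 - j) div 2 < k" using that assms by auto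
    have "j \<le> 2 * n + 1" using that by simp
    then show "j = 2 * n - 2 * ((2 * n + 1 - j) div 2) \<or> j = 2 * n - 2 * ((2 * n + 1 - j) div 2) + 1"
      by presburger
  qed
  consider "n - l < j \<and> j \<le> n + l + 1" | "\<exists>i<k. j = 2 * i + 1 \<or> j = 2 * i + 2"
    | "\<exists>i<k. j = 2 * n - 2 * i \<or> j = 2 * n - 2 * i + 1"
    | "\<not> (n - l < j \<and> j \<le> n + l + 1)" "\<not> (\<exists>i<k. j = 2 * i + 1 \<or> j = 2 * i + 2)"
      "\<not> (\<exists>i<k. j = 2 * n - 2 * i \<or> j = 2 * n - 2 * i + 1)" by blast
  then show ?thesis
  proof cases
    case 4
    then have "pattern n k l j = j" unfolding pattern_def by auto
    then show ?thesis using 4 low up fixed by blast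
  qed (use mid low1 low2 up1 up2 in blast)+
qed

lemma pattern_pattern:
  assumes "2 * k + l \<le> n"
  shows "pattern n k l (pattern n k l j) = j"
  using assms
proof (cases rule: pattern_cases[of k l n j])
  case mid
  then have "n - l < 2 * n + 2 - j" "2 * n + 2 - j \<le> n + l + 1" using assms by auto
  then show ?thesis using mid assms by (simp add: pattern_mid)
qed (simp_all only: pattern_pairs[OF assms])

lemma pattern_flip:
  assumes "2 * k + l \<le> n"
  shows "pattern n k l (flip n j) = flip n (pattern n k l j)"
proof -
  \<comment> \<open>Points that are moved are computed case by case. A fixed point whose mirror
    image is moved is then covered by applying this to the mirror image.\<close>
  have main: "pattern n k l (flip n j) = flip n (pattern n k l j)" if "pattern n k l j \<noteq> j" for j
    using assms
  proof (cases rule: pattern_cases[of k l n j])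
    case mid
    then have "n - l < 2 * n + 2 - j" "2 * n + 2 - j \<le> n + l + 1" "j \<in> {1..2 * n + 1}"
      using assms by auto
    then show ?thesis using mid assms by (simp add: pattern_mid flip_def)
  next
    case fixed
    then show ?thesis using that by simp
  qed (use assms in \<open>simp_all only: pattern_pairs[OF assms] flip_pairs[OF less_le_trans]\<close>)
  show ?thesis
  proof (cases "pattern n k l j = j")
    case True
    show ?thesis
    proof (cases "pattern n k l (flip n j) = flip n j")
      case False
      then show ?thesis using main[of "flip n j"] True by (metis flip_flip)
    qed (simp add: True)
  qed (rule main)
qed

section \<open>The pattern reverses the blocks of its parabolic subgroup\<close>

lemma pattern_le_iff:
  assumes "2 * k + l \<le> n" "t \<notin> I_kl n k l"
  shows "pattern n k l j \<le> t \<longleftrightarrow> j \<le> t"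
  using assms(1)
proof (cases rule: pattern_cases[of k l n j])
  case mid
  then show ?thesis using assms unfolding mem_I_kl_iff pattern_mid[OF mid] by auto
next
  case (low1 i)
  then have "t \<noteq> 2 * i + 1" using assms(2) unfolding mem_I_kl_iff by blast
  then show ?thesis using low1 pattern_pairs[OF assms(1) low1(1)] by auto
next
  case (low2 i)
  then have "t \<noteq> 2 * i + 1" using assms(2) unfolding mem_I_kl_iff by blast
  then show ?thesis using low2 pattern_pairs[OF assms(1) low2(1)] by auto
next
  case (up1 i)
  then have "t \<noteq> 2 * n - 2 * i" using assms(2) unfolding mem_I_kl_iff by blast
  then show ?thesis unfolding up1 pattern_pairs[OF assms(1) up1(1)] by auto
next
  case (up2 i)
  then have "t \<noteq> 2 * n - 2 * i" using assms(2) unfolding mem_I_kl_iff by blast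
  then show ?thesis unfolding up2 pattern_pairs[OF assms(1) up2(1)] by auto
qed simp

text \<open>The bound \<open>2 * k + l \<le> n\<close> separates the components of
  \<open>I_kl n k l\<close>: the outer nodes are isolated, and no node of the set adjoins the middle
  interval. A stretch of nodes therefore lies in one component.\<close>

lemma pattern_reverses:
  assumes "2 * k + l \<le> n" "i < j" "{i..<j} \<subseteq> I_kl n k l"
  shows "pattern n k l j < pattern n k l i"
proof -
  have succ: "j = Suc i" if "Suc i \<notin> I_kl n k l"
  proof (rule ccontr)
    assume "j \<noteq> Suc i"
    then have "Suc i \<in> {i..<j}" using assms(2) by auto
    then show False using assms(3) that by blast
  qed
  have "i \<in> I_kl n k l" using assms(2,3) by auto
  then consider a where "a < k" "i = 2 * a + 1" | a where "a < k" "i = 2 * n - 2 * a"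
    | "n - l < i" "i \<le> n + l" unfolding mem_I_kl_iff by blast
  then show ?thesis
  proof cases
    case 1
    have "2 * a + 2 \<noteq> 2 * b + 1" for b by presburger
    then have "Suc i \<notin> I_kl n k l" using 1 assms(1) unfolding mem_I_kl_iff by auto
    then have "j = 2 * a + 2" using succ 1 by simp
    then show ?thesis using 1 pattern_pairs[OF assms(1) 1(1)] by simp
  next
    case 2
    have "2 * n - 2 * a + 1 \<noteq> 2 * n - 2 * b" for b by presburger
    then have "Suc i \<notin> I_kl n k l" using 2 assms(1) unfolding mem_I_kl_iff by auto
    then have "j = 2 * n - 2 * a + 1" using succ 2 by simp
    then show ?thesis using 2 pattern_pairs[OF assms(1) 2(1)] by simp
  next
    case 3
    have "n + l + 1 \<noteq> 2 * n - 2 * b" if "b < k" for b using that assms(1) by auto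
    then have "n + l + 1 \<notin> I_kl n k l" using assms(1) unfolding mem_I_kl_iff by auto
    then have "n + l + 1 \<notin> {i..<j}" using assms(3) by blast
    then have "j \<le> n + l + 1" using 3 by auto
    then show ?thesis using 3 assms(1,2) by (simp add: pattern_mid)
  qed
qed

section \<open>Involutions commuting with the longest element\<close>

definition sym_invol :: "nat \<Rightarrow> (nat \<Rightarrow> nat) \<Rightarrow> bool" where
  "sym_invol n x \<longleftrightarrow> x \<in> young {1..2 * n} \<and> x \<circ> x = id \<and> x \<circ> flip n = flip n \<circ> x"

text \<open>The centre is left out: an involution commuting with the flip satisfies both
  \<open>x p = p\<close> and \<open>x p = flip n p\<close> there, so it would be counted on both
  sides of the exchange of fixed and flipped points.\<close>

definition flipped :: "nat \<Rightarrow> (nat \<Rightarrow> nat) \<Rightarrow> nat set" where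
  "flipped n x = {p \<in> {1..2 * n + 1}. flip n p \<noteq> p \<and> x p = flip n p}"

definition moved :: "nat \<Rightarrow> (nat \<Rightarrow> nat) \<Rightarrow> nat set" where
  "moved n x = {p \<in> {1..2 * n + 1}. flip n p \<noteq> p \<and> x p \<noteq> p \<and> x p \<noteq> flip n p}"

lemma young_in_iff: "x \<in> young {1..2 * n} \<Longrightarrow> x p \<in> {1..2 * n + 1} \<longleftrightarrow> p \<in> {1..2 * n + 1}"
  using permutes_in_image[OF young_permutes] by fastforce

lemma flip_permutes: "flip n permutes {1..Suc (2 * n)}"
proof -
  have "flip n p = p" if "p \<notin> {1..Suc (2 * n)}" for p using that by (auto simp: flip_def)
  moreover have "bij (flip n)" by (rule involuntory_imp_bij) (rule flip_flip)
  ultimately show ?thesis unfolding permutes_def bij_iff by blast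
qed

lemma flip_young: "flip n \<in> young {1..2 * n}"
  by (rule permutes_young[OF flip_permutes])

lemma pattern_young:
  assumes "2 * k + l \<le> n"
  shows "pattern n k l \<in> young (I_kl n k l)"
proof -
  have "bij (pattern n k l)" by (rule involuntory_imp_bij) (rule pattern_pattern[OF assms])
  then show ?thesis using pattern_le_iff[OF assms] by (simp add: young_def)
qed

lemma kl_pairs_iff: "(k, l) \<in> kl_pairs n \<longleftrightarrow> 2 * k + l \<le> n"
  unfolding kl_pairs_def mem_Collect_eq case_prod_conv by presburger

section \<open>Longest elements, centralizer and conjugacy in terms of permutations\<close>

lemma c_kl_perm_class:
  assumes "2 * k + l \<le> n"
  shows "c_kl n k l = perm_class (2 * n) (pattern n k l)"
  unfolding c_kl_def
  by (rule A_longest_eqI[OF I_kl_subset[OF assms] pattern_young[OF assms] pattern_reverses[OF assms]])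

lemma A_w0_perm_class: "A_w0 (2 * n) = perm_class (2 * n) (flip n)"
  unfolding A_w0_def
proof (rule A_longest_eqI[OF subset_refl flip_young])
  fix i j assume "i < j" "{i..<j} \<subseteq> {1..2 * n}"
  moreover from this(1) have "i \<in> {i..<j}" "j - 1 \<in> {i..<j}" by auto
  ultimately have "i < j" "i \<in> {1..2 * n}" "j - 1 \<in> {1..2 * n}" by blast+
  then show "flip n j < flip n i" by (auto simp: flip_def)
qed

lemma A_W0_perm_class:
  "A_W0 (2 * n) = perm_class (2 * n) ` {f \<in> young {1..2 * n}. f \<circ> flip n = flip n \<circ> f}"
proof -
  have "perm_class (2 * n) f \<otimes>\<^bsub>A_group (2 * n)\<^esub> A_w0 (2 * n)
      = A_w0 (2 * n) \<otimes>\<^bsub>A_group (2 * n)\<^esub> perm_class (2 * n) f \<longleftrightarrow> f \<circ> flip n = flip n \<circ> f"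
    if "f \<in> young {1..2 * n}" for f
    unfolding A_w0_perm_class perm_class_mult[OF that flip_young] perm_class_mult[OF flip_young that]
    by (rule perm_class_eq_iff[OF young_comp[OF that flip_young]])
  then show ?thesis unfolding A_W0_def carrier_A_group by blast
qed

lemma involution_perm_class_iff:
  assumes "f \<in> young {1..r}"
  shows "involution (A_group r) (perm_class r f) \<longleftrightarrow> f \<circ> f = id"
proof -
  have "perm_class r f \<in> carrier (A_group r)" using assms carrier_A_group by blast
  moreover have "perm_class r (f \<circ> f) = perm_class r id \<longleftrightarrow> f \<circ> f = id"
    by (rule perm_class_eq_iff[OF young_comp[OF assms assms]])
  ultimately show ?thesis
    unfolding involution_def perm_class_mult[OF assms assms] perm_class_one by blast
qed

lemma conjugate_in_perm_class_iff:
  assumes "x \<in> young {1..2 * n}" "y \<in> young {1..2 * n}"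
  shows "conjugate_in (A_group (2 * n)) (A_W0 (2 * n)) (perm_class (2 * n) x) (perm_class (2 * n) y)
    \<longleftrightarrow> (\<exists>g \<in> young {1..2 * n}. g \<circ> flip n = flip n \<circ> g \<and> y = g \<circ> x \<circ> fun_inv g)"
proof -
  have "perm_class (2 * n) y = perm_class (2 * n) g \<otimes>\<^bsub>A_group (2 * n)\<^esub> perm_class (2 * n) x
      \<otimes>\<^bsub>A_group (2 * n)\<^esub> inv\<^bsub>A_group (2 * n)\<^esub> (perm_class (2 * n) g) \<longleftrightarrow> y = g \<circ> x \<circ> fun_inv g"
    if g: "g \<in> young {1..2 * n}" for g
    unfolding perm_class_inv[OF g] perm_class_mult[OF g assms(1)]
      perm_class_mult[OF young_comp[OF g assms(1)] young_inv[OF g]]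
    by (rule perm_class_eq_iff[OF assms(2)])
  then show ?thesis unfolding conjugate_in_def A_W0_perm_class by blast
qed

lemma sym_involD:
  assumes "sym_invol n x"
  shows "x \<in> young {1..2 * n}" "x (x p) = p" "x (flip n p) = flip n (x p)"
    "x p \<in> {1..2 * n + 1} \<longleftrightarrow> p \<in> {1..2 * n + 1}"
proof -
  show x: "x \<in> young {1..2 * n}" using assms by (simp only: sym_invol_def)
  have "x \<circ> x = id" "x \<circ> flip n = flip n \<circ> x" using assms by (simp_all only: sym_invol_def)
  then show "x (x p) = p" "x (flip n p) = flip n (x p)" unfolding fun_eq_iff comp_apply id_apply by blast+
  show "x p \<in> {1..2 * n + 1} \<longleftrightarrow> p \<in> {1..2 * n + 1}" by (rule young_in_iff[OF x])
qed

lemma sym_involI: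
  assumes "x \<in> young {1..2 * n}" "\<And>p. x (x p) = p" "\<And>p. x (flip n p) = flip n (x p)"
  shows "sym_invol n x"
  using assms unfolding sym_invol_def fun_eq_iff comp_apply id_apply by blast

lemma sym_invol_commuting:
  assumes "sym_invol n x" "X \<subseteq> {1..2 * n + 1}" "\<And>p. p \<in> X \<Longrightarrow> flip n p \<in> X" "\<And>p. p \<in> X \<Longrightarrow> x p \<in> X"
  shows "commuting_invols X (flip n) x"
  unfolding commuting_invols_def using assms flip_flip sym_involD(2,3)[OF assms(1)] by simp

text \<open>Commuting with the flip, \<open>x\<close> permutes the fixed points of the flip, and
  \<open>n + 1\<close> is the only one in the range.\<close>

lemma sym_invol_center:
  assumes "sym_invol n x" "p \<in> {1..2 * n + 1}" "flip n p = p"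
  shows "x p = p"
proof -
  have "flip n (x p) = x p" using sym_involD(3)[OF assms(1), of p] assms(3) by simp
  moreover have "x p \<in> {1..2 * n + 1}" using sym_involD(4)[OF assms(1)] assms(2) by blast
  ultimately have "x p = n + 1" by (simp only: flip_eq_self_iff)
  moreover have "p = n + 1" using assms(2,3) by (simp only: flip_eq_self_iff)
  ultimately show ?thesis by simp
qed

section \<open>Counting points by orbit type\<close>

lemma sym_invol_partition:
  assumes "sym_invol n x"
  shows "{p \<in> {1..2 * n + 1}. flip n p \<noteq> p \<and> x p = p}
      = {1..2 * n + 1} - {n + 1} - (flipped n x \<union> moved n x)"
    and "card {p \<in> {1..2 * n + 1}. flip n p \<noteq> p \<and> x p = p}
      = 2 * n - (card (flipped n x) + card (moved n x))"
    and "card (flipped n x) + card (moved n x) \<le> 2 * n"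
proof -
  let ?X = "{1..2 * n + 1}"
  have free: "?X - {n + 1} = {p \<in> ?X. flip n p \<noteq> p}" using flip_eq_self_iff by blast
  show eq: "{p \<in> ?X. flip n p \<noteq> p \<and> x p = p} = ?X - {n + 1} - (flipped n x \<union> moved n x)"
    unfolding free by (auto simp: flipped_def moved_def)
  have sub: "flipped n x \<union> moved n x \<subseteq> ?X - {n + 1}"
    unfolding free by (auto simp: flipped_def moved_def)
  have fin: "finite (flipped n x)" "finite (moved n x)" by (simp_all add: flipped_def moved_def)
  have un: "card (flipped n x \<union> moved n x) = card (flipped n x) + card (moved n x)"
    using fin by (intro card_Un_disjoint) (auto simp: flipped_def moved_def)
  have X: "card (?X - {n + 1}) = 2 * n" by simp
  show "card (flipped n x) + card (moved n x) \<le> 2 * n"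
    using card_mono[OF _ sub] X un by simp
  show "card {p \<in> ?X. flip n p \<noteq> p \<and> x p = p} = 2 * n - (card (flipped n x) + card (moved n x))"
    unfolding eq using card_Diff_subset[OF _ sub] fin X un by simp
qed

lemma even_card_flipped:
  assumes "sym_invol n x"
  shows "2 dvd card (flipped n x)"
proof (rule card_dvd_by_orbits)
  note x = sym_involD[OF assms]
  show "commuting_invols (flipped n x) (flip n) x"
  proof (rule sym_invol_commuting[OF assms])
    show *: "flip n p \<in> flipped n x" if "p \<in> flipped n x" for p
      using that x(3)[of p] flip_in_iff[of n p] flip_flip[of n p] unfolding flipped_def by auto
    show "x p \<in> flipped n x" if "p \<in> flipped n x" for p
      using *[OF that] that unfolding flipped_def by simp
  qed (auto simp: flipped_def)
  show "card (four_orbit (flip n) x p) = 2" if "p \<in> flipped n x" for p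
  proof -
    have "x p = flip n p" "flip n p \<noteq> p" "x (flip n p) = p"
      using that x(3)[of p] flip_flip[of n p] unfolding flipped_def by auto
    then show ?thesis unfolding four_orbit_def by (simp add: card_insert_if)
  qed
qed (simp add: flipped_def)

text \<open>At a moved point no two of the four group elements agree, so its orbit is free.\<close>

lemma four_dvd_card_moved:
  assumes "sym_invol n x"
  shows "4 dvd card (moved n x)"
proof (rule card_dvd_by_orbits)
  note x = sym_involD[OF assms]
  have flip_inj: "flip n a = flip n b \<longleftrightarrow> a = b" for a b by (metis flip_flip)
  have x_inj: "x a = x b \<longleftrightarrow> a = b" for a b by (metis x(2))
  show "commuting_invols (moved n x) (flip n) x"
  proof (rule sym_invol_commuting[OF assms])
    show "flip n p \<in> moved n x" if "p \<in> moved n x" for p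
      using that flip_in_iff[of n p] unfolding moved_def mem_Collect_eq x(3) flip_inj by auto
    show "x p \<in> moved n x" if "p \<in> moved n x" for p
      using that x(4)[of p] unfolding moved_def mem_Collect_eq x(3)[symmetric] x_inj by auto
  qed (auto simp: moved_def)
  show "card (four_orbit (flip n) x p) = 4" if "p \<in> moved n x" for p
  proof -
    have p: "flip n p \<noteq> p" "x p \<noteq> p" "x p \<noteq> flip n p" using that unfolding moved_def by auto
    have "x (flip n p) \<noteq> p" using p(3) x(2)[of "flip n p"] by auto
    moreover have "x (flip n p) \<noteq> flip n p" using p(2) by (simp only: x(3) flip_inj not_False_eq_True)
    moreover have "x (flip n p) \<noteq> x p" using p(1) by (simp only: x_inj not_False_eq_True)
    ultimately have "distinct [p, flip n p, x p, x (flip n p)]" using p by auto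
    then have "card (set [p, flip n p, x p, x (flip n p)]) = 4" by (simp only: distinct_card) simp
    then show ?thesis unfolding four_orbit_def by (simp only: list.set)
  qed
qed (simp add: moved_def)

text \<open>Four of the eight triples survive. Transitivity of equality rules out those with exactly
  two true entries, and a point fixed by the flip is fixed by \<open>x\<close>, which rules out
  \<open>(True, False, False)\<close>. All counts thus depend on \<open>n\<close> and two numbers
  only.\<close>

lemma card_orbit_type:
  assumes "sym_invol n x"
  shows "card {p \<in> {1..2 * n + 1}. orbit_type (flip n) x p = t} =
    (if t = (False, False, True) then card (flipped n x)
     else if t = (False, False, False) then card (moved n x)
     else if t = (True, True, True) then 1
     else if t = (False, True, False) then 2 * n - (card (flipped n x) + card (moved n x))
     else 0)"
proof -
  let ?X = "{1..2 * n + 1}"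
  let ?E = "\<lambda>t. {p \<in> ?X. orbit_type (flip n) x p = t}"
  have center: "x p = p" if "p \<in> ?X" "flip n p = p" for p
    by (rule sym_invol_center[OF assms that])
  obtain u v w where t: "t = (u, v, w)" by (cases t)
  have 1: "?E (False, False, True) = flipped n x" "?E (False, False, False) = moved n x"
    "?E (False, True, False) = {p \<in> ?X. flip n p \<noteq> p \<and> x p = p}"
    unfolding orbit_type_def flipped_def moved_def by auto
  have "?E (True, True, True) = {p \<in> ?X. flip n p = p}"
    unfolding orbit_type_def using center by auto
  also have "\<dots> = {p \<in> ?X. p = n + 1}" using flip_eq_self_iff[of _ n] by blast
  also have "\<dots> = {n + 1}" by auto
  finally have 2: "card (?E (True, True, True)) = 1" by simp
  have 3: "?E (True, True, False) = {}" "?E (True, False, w) = {}" "?E (False, True, True) = {}"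
    unfolding orbit_type_def using center by auto
  show ?thesis
    unfolding t using 3
    by (cases u; cases v; cases w)
      (simp_all only: 1 2 sym_invol_partition(2)[OF assms] prod.inject simp_thms if_True if_False card.empty)
qed

section \<open>Conjugacy is decided by the two counts\<close>

lemma sym_invol_conjugateI:
  assumes x: "sym_invol n x" and y: "sym_invol n y"
    and "card (flipped n x) = card (flipped n y)" "card (moved n x) = card (moved n y)"
  shows "\<exists>g \<in> young {1..2 * n}. g \<circ> flip n = flip n \<circ> g \<and> y = g \<circ> x \<circ> fun_inv g"
proof -
  let ?X = "{1..2 * n + 1}"
  have comm: "commuting_invols ?X (flip n) z" if "sym_invol n z" for z
    using sym_involD(4)[OF that] flip_in_iff by (intro sym_invol_commuting[OF that]) blast+
  have "\<exists>h. bij_betw h ?X ?X \<and> (\<forall>p\<in>?X. h (flip n p) = flip n (h p) \<and> h (x p) = y (h p))"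
    by (rule ex_equivariant_bij[OF _ _ comm[OF x] comm[OF y]])
      (simp_all only: card_orbit_type[OF x] card_orbit_type[OF y] assms(3,4) finite_atLeastAtMost)
  then obtain h where h: "bij_betw h ?X ?X"
    "\<And>p. p \<in> ?X \<Longrightarrow> h (flip n p) = flip n (h p) \<and> h (x p) = y (h p)"
    by blast
  \<comment> \<open>Nothing is known about \<open>h\<close> outside the range, so the identity
    replaces it there; the flip, \<open>x\<close> and \<open>y\<close> are the identity there too,
    which preserves equivariance.\<close>
  define g where "g p = (if p \<in> ?X then h p else p)" for p
  have gX: "g p \<in> ?X \<longleftrightarrow> p \<in> ?X" for p using bij_betwE[OF h(1)] by (auto simp: g_def)
  have "bij_betw g ?X ?X" using h(1) by (rule bij_betw_cong[THEN iffD1, rotated]) (simp add: g_def)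
  then have "g permutes ?X" by (rule bij_imp_permutes) (simp only: g_def if_False)
  then have g: "g \<in> young {1..2 * n}" by (intro permutes_young) simp
  have out: "f p = p" if "f \<in> young {1..2 * n}" "p \<notin> ?X" for f p
    using permutes_not_in[OF young_permutes[OF that(1)]] that(2) by simp
  have "g (flip n p) = flip n (g p)" for p
  proof (cases "p \<in> ?X")
    case True
    then show ?thesis using h(2)[OF True] flip_in_iff[of n p] by (simp only: g_def if_True)
  next
    case False
    then show ?thesis using out[OF flip_young False] by (simp only: g_def if_False)
  qed
  moreover have gx: "g (x p) = y (g p)" for p
  proof (cases "p \<in> ?X")
    case True
    then show ?thesis using h(2)[OF True] sym_involD(4)[OF x, of p] by (simp only: g_def if_True)
  next
    case False
    then show ?thesis
      using out[OF sym_involD(1)[OF x] False] out[OF sym_involD(1)[OF y] False]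
      by (simp only: g_def if_False)
  qed
  have "y = g \<circ> x \<circ> fun_inv g"
  proof
    fix p
    have "g (fun_inv g p) = p" using young_bij[OF g] by (simp add: bij_is_surj surj_f_inv_f)
    then show "y p = (g \<circ> x \<circ> fun_inv g) p" by (simp only: comp_apply gx)
  qed
  ultimately show ?thesis using g by (auto simp only: fun_eq_iff comp_apply)
qed

lemma conjugate_same_counts:
  assumes g: "g \<in> young {1..2 * n}" and comm: "g \<circ> flip n = flip n \<circ> g"
    and y: "y = g \<circ> x \<circ> fun_inv g"
  shows "card (flipped n x) = card (flipped n y)" "card (moved n x) = card (moved n y)"
proof -
  have inj: "inj g" using young_bij[OF g] by (rule bij_is_inj)
  have gf: "flip n (g p) = g (flip n p)" for p using fun_cong[OF comm, of p] by simp
  have gx: "y (g p) = g (x p)" for p unfolding y by (simp add: inj)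
  have mem: "g p \<in> flipped n y \<longleftrightarrow> p \<in> flipped n x" "g p \<in> moved n y \<longleftrightarrow> p \<in> moved n x" for p
    unfolding flipped_def moved_def mem_Collect_eq gf gx inj_eq[OF inj] young_in_iff[OF g]
    by (rule HOL.refl)+
  have *: "card A = card B" if "\<And>p. g p \<in> B \<longleftrightarrow> p \<in> A" for A B
  proof -
    have "g ` A = B"
    proof
      show "B \<subseteq> g ` A"
      proof
        fix q assume q: "q \<in> B"
        have "g (fun_inv g q) = q" using young_bij[OF g] by (simp add: bij_is_surj surj_f_inv_f)
        with q that[of "fun_inv g q"] show "q \<in> g ` A" by (metis imageI)
      qed
    qed (use that in blast)
    then show ?thesis using card_image[OF inj_on_subset[OF inj subset_UNIV], of A] by simp
  qed
  show "card (flipped n x) = card (flipped n y)" "card (moved n x) = card (moved n y)"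
    by (rule *[OF mem(1)], rule *[OF mem(2)])
qed

section \<open>Counts of the representatives and of products with the flip\<close>

lemma sym_invol_pattern:
  assumes "2 * k + l \<le> n"
  shows "sym_invol n (pattern n k l)"
proof (rule sym_involI)
  show "pattern n k l \<in> young {1..2 * n}"
    using young_mono[OF I_kl_subset[OF assms]] pattern_young[OF assms] by blast
qed (simp_all only: pattern_pattern[OF assms] pattern_flip[OF assms])

lemma card_flipped_moved_pattern:
  assumes "2 * k + l \<le> n"
  shows "card (flipped n (pattern n k l)) = 2 * l" "card (moved n (pattern n k l)) = 4 * k"
proof -
  \<comment> \<open>\<open>?F\<close> is the reversed middle block without its centre;
    \<open>?M\<close> consists of the first and the last \<open>2 * k\<close> points, where
    exchanging neighbours agrees with neither the identity nor the flip.\<close>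
  let ?F = "{n - l + 1..n + l + 1} - {n + 1}" and ?M = "{1..2 * k} \<union> {2 * n + 2 - 2 * k..2 * n + 1}"
  have mem: "(j \<in> flipped n (pattern n k l) \<longleftrightarrow> j \<in> ?F) \<and> (j \<in> moved n (pattern n k l) \<longleftrightarrow> j \<in> ?M)" for j
    using assms
  proof (cases rule: pattern_cases[of k l n j])
    case mid
    then have "pattern n k l j = flip n j" "j \<in> {1..2 * n + 1}" "j \<notin> ?M" "j \<in> {n - l + 1..n + l + 1}"
      using assms by (auto simp: pattern_mid flip_def)
    then show ?thesis unfolding flipped_def moved_def using flip_eq_self_iff[of j n] by blast
  next
    case (low1 i)
    then have "i < n" "i < k" using assms by auto
    then show ?thesis
      unfolding low1 flipped_def moved_def mem_Collect_eq flip_pairs[OF \<open>i < n\<close>] pattern_pairs[OF assms low1(1)]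
      using assms by (auto; presburger)
  next
    case (low2 i)
    then have "i < n" "i < k" using assms by auto
    then show ?thesis
      unfolding low2 flipped_def moved_def mem_Collect_eq flip_pairs[OF \<open>i < n\<close>] pattern_pairs[OF assms low2(1)]
      using assms by (auto; presburger)
  next
    case (up1 i)
    then have "i < n" "i < k" using assms by auto
    then show ?thesis
      unfolding up1 flipped_def moved_def mem_Collect_eq flip_pairs[OF \<open>i < n\<close>] pattern_pairs[OF assms up1(1)]
      using assms by (auto; presburger)
  next
    case (up2 i)
    then have "i < n" "i < k" using assms by auto
    then show ?thesis
      unfolding up2 flipped_def moved_def mem_Collect_eq flip_pairs[OF \<open>i < n\<close>] pattern_pairs[OF assms up2(1)]
      using assms by (auto; presburger)
  next
    case fixed
    then show ?thesis unfolding flipped_def moved_def mem_Collect_eq fixed(1) by auto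
  qed
  have "flipped n (pattern n k l) = ?F" "moved n (pattern n k l) = ?M"
    using mem by blast+
  moreover have "card ?F = 2 * l" using assms by simp
  moreover have "card ?M = 4 * k"
    using assms by (subst card_Un_disjoint) auto
  ultimately show "card (flipped n (pattern n k l)) = 2 * l" "card (moved n (pattern n k l)) = 4 * k"
    by simp_all
qed

lemma sym_invol_flip_comp:
  assumes "sym_invol n x"
  shows "sym_invol n (flip n \<circ> x)"
proof (rule sym_involI)
  show "flip n \<circ> x \<in> young {1..2 * n}" by (rule young_comp[OF flip_young sym_involD(1)[OF assms]])
qed (simp_all only: comp_apply sym_involD(2,3)[OF assms] flip_flip)

text \<open>As the flip is injective, \<open>flip n (x p) = flip n p\<close> means
  \<open>x p = p\<close>: the flipped points of the product are the noncentral fixed points of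
  \<open>x\<close>.\<close>

lemma counts_flip_comp:
  assumes "sym_invol n x"
  shows "card (flipped n (flip n \<circ> x)) = 2 * n - (card (flipped n x) + card (moved n x))"
    and "moved n (flip n \<circ> x) = moved n x"
proof -
  have 1: "flip n (x p) = flip n p \<longleftrightarrow> x p = p" "flip n (x p) = p \<longleftrightarrow> x p = flip n p" for p
    by (metis flip_flip)+
  show "card (flipped n (flip n \<circ> x)) = 2 * n - (card (flipped n x) + card (moved n x))"
    unfolding flipped_def[of n "flip n \<circ> x"] comp_apply 1 by (rule sym_invol_partition(2)[OF assms])
  show "moved n (flip n \<circ> x) = moved n x" unfolding moved_def comp_apply 1 by blast
qed

theorem mainTheorem1:
  fixes n :: nat
  assumes "n \<ge> 1"
  shows "(\<forall>(k, l)\<in>kl_pairs n. c_kl n k l \<in> A_W0 (2 * n) \<and> involution (A_group (2 * n)) (c_kl n k l))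
    \<and> (\<forall>x\<in>A_W0 (2 * n). involution (A_group (2 * n)) x \<longrightarrow>
         (\<exists>!p. p \<in> kl_pairs n \<and> conjugate_in (A_group (2 * n)) (A_W0 (2 * n)) x (c_kl n (fst p) (snd p))))
    \<and> (\<forall>(k, l)\<in>kl_pairs n.
         conjugate_in (A_group (2 * n)) (A_W0 (2 * n))
           (A_w0 (2 * n) \<otimes>\<^bsub>A_group (2 * n)\<^esub> c_kl n k l) (c_kl n k (n - 2 * k - l)))"
proof -
  let ?G = "A_group (2 * n)" and ?H = "A_W0 (2 * n)" and ?c = "perm_class (2 * n)"
  have mem: "?c f \<in> ?H \<and> involution ?G (?c f)" if "sym_invol n f" for f
    using that involution_perm_class_iff unfolding A_W0_perm_class sym_invol_def by blast
  have conj: "conjugate_in ?G ?H (?c x) (?c y) \<longleftrightarrow>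
      card (flipped n x) = card (flipped n y) \<and> card (moved n x) = card (moved n y)"
    if "sym_invol n x" "sym_invol n y" for x y
    unfolding conjugate_in_perm_class_iff[OF sym_involD(1)[OF that(1)] sym_involD(1)[OF that(2)]]
    using sym_invol_conjugateI[OF that] conjugate_same_counts by blast
  have conj_c: "conjugate_in ?G ?H (?c x) (c_kl n k l) \<longleftrightarrow>
      card (flipped n x) = 2 * l \<and> card (moved n x) = 4 * k"
    if "sym_invol n x" "2 * k + l \<le> n" for x k l
    unfolding c_kl_perm_class[OF that(2)] conj[OF that(1) sym_invol_pattern[OF that(2)]]
      card_flipped_moved_pattern[OF that(2)] by (rule HOL.refl)
  have "c_kl n k l \<in> ?H \<and> involution ?G (c_kl n k l)" if "2 * k + l \<le> n" for k l
    unfolding c_kl_perm_class[OF that] by (rule mem[OF sym_invol_pattern[OF that]])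
  moreover have "\<exists>!p. p \<in> kl_pairs n \<and> conjugate_in ?G ?H X (c_kl n (fst p) (snd p))"
    if X: "X \<in> ?H" "involution ?G X" for X
  proof -
    obtain x where x: "X = ?c x" "x \<in> young {1..2 * n}" "x \<circ> flip n = flip n \<circ> x"
      using X(1) unfolding A_W0_perm_class by blast
    have inv: "sym_invol n x"
      using X(2) x unfolding sym_invol_def x(1) involution_perm_class_iff[OF x(2)] by blast
    obtain l k where l: "card (flipped n x) = 2 * l" and k: "card (moved n x) = 4 * k"
      using even_card_flipped[OF inv] four_dvd_card_moved[OF inv] by (auto elim!: dvdE)
    \<comment> \<open>The noncentral points number \<open>2 * n\<close>, so
      \<open>2 * l + 4 * k \<le> 2 * n\<close>; halving it gives admissibility.\<close>
    have kl: "2 * k + l \<le> n" using sym_invol_partition(3)[OF inv] l k by simp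
    show ?thesis
    proof (rule ex1I[of _ "(k, l)"])
      show "(k, l) \<in> kl_pairs n \<and> conjugate_in ?G ?H X (c_kl n (fst (k, l)) (snd (k, l)))"
        using kl l k by (simp only: kl_pairs_iff x(1) fst_conv snd_conv conj_c[OF inv kl] simp_thms)
    next
      fix p assume p: "p \<in> kl_pairs n \<and> conjugate_in ?G ?H X (c_kl n (fst p) (snd p))"
      obtain k' l' where p': "p = (k', l')" by (cases p)
      have "2 * k' + l' \<le> n" using p unfolding p' kl_pairs_iff by blast
      then have "card (flipped n x) = 2 * l' \<and> card (moved n x) = 4 * k'"
        using p conj_c[OF inv] unfolding p' x(1) fst_conv snd_conv by blast
      then show "p = (k, l)" using l k p' by simp
    qed
  qed
  moreover have "conjugate_in ?G ?H (A_w0 (2 * n) \<otimes>\<^bsub>?G\<^esub> c_kl n k l) (c_kl n k (n - 2 * k - l))"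
    if kl: "2 * k + l \<le> n" for k l
  proof -
    note x = sym_invol_pattern[OF kl]
    \<comment> \<open>The target pair is admissible, and its index fits because
      \<open>2 * n - (2 * l + 4 * k)\<close> is twice \<open>n - 2 * k - l\<close>.\<close>
    have kl': "2 * k + (n - 2 * k - l) \<le> n" using kl by simp
    show ?thesis
      unfolding c_kl_perm_class[OF kl] A_w0_perm_class perm_class_mult[OF flip_young sym_involD(1)[OF x]]
        conj_c[OF sym_invol_flip_comp[OF x] kl'] counts_flip_comp[OF x] card_flipped_moved_pattern[OF kl]
      using kl by auto
  qed
  ultimately show ?thesis using kl_pairs_iff by blast
qed

end
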